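(* For every $n\ge2$ and $\alpha\in(0,1/2)$ there is a constant $C_0>0$ depending only on $n$ and $\alpha$ such that the following holds. Let $\mathcal G=(V,E)$ be a connected, non-bipartite undirected graph with $V=[n]$, let $\mathbf X=(X_1,\dots,X_n)^\top$ have pairwise distinct real entries with ranks $r_1,\dots,r_n$ and $\alpha$-trimmed mean $\bar x_\alpha$, and let $\mathbf N(t)$ be the (synchronous) GoTrim estimate defined in the context. Then there exists $T^*>0$ such that for every integer $t>T^*$, $$\mathbb E\big\|\mathbf N(t)-\bar x_\alpha\mathbf 1_n\big\|_2\le\frac{C_0}{\tilde c\sqrt{ct}}\cdot\|\mathbf K\odot\mathbf X\|,$$ where $\mathbf K=\left(\frac{\sqrt6\,\sigma_n(r_i)}{\gamma_i(1-2\alpha)}\right)_{i=1}^n$, $\tilde c=1-\sqrt{\lambda_2(2)}$, $\lambda_2(2)=1-c/2$ is the second largest eigenvalue of $\mathbf W_2=\mathbf I_n-\frac12\mathbf L(P)$, and $c$ is the second smallest eigenvalue of $\mathbf L(P)=\sum_{e\in E}p_e\mathbf L_e$.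
   Context: Graph and edge sampling: $\mathcal G=(V,E)$ is a connected, non-bipartite undirected graph on $V=[n]=\{1,\dots,n\}$, $n\ge2$; $d_i$ is the degree of node $i$. Node $k$ holds the (fixed) real number $X_k$, with no ties. Edges $e_1,e_2,\dots$ are drawn i.i.d. from $E$, with edge $e=(i,j)$ having probability $p_e=\frac1n\left(\frac1{d_i}+\frac1{d_j}\right)$. For $e=(i,j)$ let $\mathbf L_e=(\mathbf e_i-\mathbf e_j)(\mathbf e_i-\mathbf e_j)^\top$, where $\mathbf e_1,\dots,\mathbf e_n$ is the canonical basis. Put $\mathbf W_1(s)=\mathbf I_n-\mathbf L_{e_s}$ (swapping matrix), $\mathbf W_2(s)=\mathbf I_n-\frac12\mathbf L_{e_s}$ (averaging matrix) and $\mathbf W_2(t{:}s)=\mathbf W_2(t)\mathbf W_2(t-1)\cdots\mathbf W_2(s)$. $\|\cdot\|=\|\cdot\|_2$ is the Euclidean norm, $\mathbf 1_n$ the all-ones vector, $\odot$ the entrywise product. Ranks and trimmed mean: $r_k=1+\sum_{l=1}^n\mathbb I_{\{X_k>X_l\}}$; $m=\lfloor\alpha n\rfloor$, $a=m+\frac12$, $b=n-m+\frac12$, $I_{n,\alpha}=[a,b]$, $c_{n,\alpha}=1-2m/n$, $w_{n,\alpha}(r)=\mathbb I_{\{r\in I_{n,\alpha}\}}/c_{n,\alpha}$, and $\bar x_\alpha=\frac1n\sum_{k=1}^nw_{n,\alpha}(r_k)X_k$. Moreover $\gamma_k=\min(|r_k-a|,|r_k-b|)$ and $\sigma_n(r_k)=n^{3/2}\phi((r_k-1)/n)$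 with $\phi(u)=\sqrt{u(1-u)}$. Synchronous rank estimates (all nodes update at every step): $Y_k(0)=X_k$, $\mathbf Y(s)=\mathbf W_1(s)\mathbf Y(s-1)$ for $s\ge1$, and $R_k(t)=1+\frac nt\sum_{s=1}^t\mathbb I_{\{X_k>Y_k(s-1)\}}$ for $t\ge1$. GoTrim: $W_k(0)=0$, $W_k(s)=w_{n,\alpha}(R_k(s))$ for $s\ge1$, $\Delta\boldsymbol W(s)=\boldsymbol W(s)-\boldsymbol W(s-1)$ with $\boldsymbol W(s)=(W_1(s),\dots,W_n(s))^\top$, and $$\mathbf N(t)=\sum_{s=1}^t\mathbf W_2(t{:}s)\,\big(\Delta\boldsymbol W(s)\odot\mathbf X\big),$$ the same edges $e_s$ being used for averaging and swapping. *)

theory Defs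
  imports "HOL-Probability.Probability" "Jordan_Normal_Form.Char_Poly"
begin

unbundle no vec_syntax
unbundle no inner_syntax
hide_const (open) Finite_Cartesian_Product.vec Finite_Cartesian_Product.mat

text \<open>
  Nodes are numbered from 0, so the node set is \<open>{..<n}\<close>. An undirected simple graph is given by
  its edge set, each edge being listed once as a pair with the smaller endpoint first.
\<close>

definition graph_on :: "nat \<Rightarrow> (nat \<times> nat) set \<Rightarrow> bool" where
  "graph_on n E \<longleftrightarrow> E \<subseteq> {(i, j). i < j \<and> j < n}"

definition degree_of :: "(nat \<times> nat) set \<Rightarrow> nat \<Rightarrow> nat" where
  "degree_of E k = card {e \<in> E. fst e = k \<or> snd e = k}"

definition connected_graph :: "nat \<Rightarrow> (nat \<times> nat) set \<Rightarrow> bool" where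
  "connected_graph n E \<longleftrightarrow> (\<forall>u<n. \<forall>v<n. (u, v) \<in> (E \<union> E\<inverse>)\<^sup>*)"

definition bipartite_graph :: "nat \<Rightarrow> (nat \<times> nat) set \<Rightarrow> bool" where
  "bipartite_graph n E \<longleftrightarrow> (\<exists>A B. A \<union> B = {..<n} \<and> A \<inter> B = {} \<and>
     (\<forall>(i, j)\<in>E. (i \<in> A \<and> j \<in> B) \<or> (i \<in> B \<and> j \<in> A)))"

definition edge_prob :: "nat \<Rightarrow> (nat \<times> nat) set \<Rightarrow> nat \<times> nat \<Rightarrow> real" where
  "edge_prob n E = (\<lambda>(i, j). 1 / real n * (1 / real (degree_of E i) + 1 / real (degree_of E j)))"

definition edge_pmf :: "nat \<Rightarrow> (nat \<times> nat) set \<Rightarrow> (nat \<times> nat) pmf" where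
  "edge_pmf n E = embed_pmf (\<lambda>e. if e \<in> E then edge_prob n E e else 0)"

text \<open>The canonical space carrying the i.i.d. edges \<open>\<omega> 1, \<omega> 2, \<dots>\<close>.\<close>

definition edge_process :: "nat \<Rightarrow> (nat \<times> nat) set \<Rightarrow> (nat \<Rightarrow> nat \<times> nat) measure" where
  "edge_process n E = (\<Pi>\<^sub>M s\<in>{1..}. measure_pmf (edge_pmf n E))"

definition edge_laplacian :: "nat \<Rightarrow> nat \<times> nat \<Rightarrow> real mat" where
  "edge_laplacian n = (\<lambda>(i, j). let v = unit_vec n i - unit_vec n j
     in mat n n (\<lambda>(k, l). v $ k * v $ l))"

definition mean_laplacian :: "nat \<Rightarrow> (nat \<times> nat) set \<Rightarrow> real mat" where
  "mean_laplacian n E = mat n n (\<lambda>(k, l). \<Sum>e\<in>E. edge_prob n E e * edge_laplacian n e $$ (k, l))"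

definition swap_mat :: "nat \<Rightarrow> nat \<times> nat \<Rightarrow> real mat" where
  "swap_mat n e = 1\<^sub>m n - edge_laplacian n e"

definition avg_mat :: "nat \<Rightarrow> nat \<times> nat \<Rightarrow> real mat" where
  "avg_mat n e = 1\<^sub>m n - (1/2) \<cdot>\<^sub>m edge_laplacian n e"

definition mean_avg_mat :: "nat \<Rightarrow> (nat \<times> nat) set \<Rightarrow> real mat" where
  "mean_avg_mat n E = 1\<^sub>m n - (1/2) \<cdot>\<^sub>m mean_laplacian n E"

text \<open>\<open>avg_prod n \<omega> s t\<close> is the product \<open>W(t) W(t - 1) \<cdots> W(s)\<close>, equal to the identity if \<open>t < s\<close>.\<close>

primrec avg_prod :: "nat \<Rightarrow> (nat \<Rightarrow> nat \<times> nat) \<Rightarrow> nat \<Rightarrow> nat \<Rightarrow> real mat" where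
  "avg_prod n \<omega> s 0 = 1\<^sub>m n"
| "avg_prod n \<omega> s (Suc t) =
     (if s \<le> Suc t then avg_mat n (\<omega> (Suc t)) * avg_prod n \<omega> s t else 1\<^sub>m n)"

definition vec_norm2 :: "real vec \<Rightarrow> real" where
  "vec_norm2 v = L2_set (\<lambda>i. v $ i) {..<dim_vec v}"

text \<open>
  All eigenvalues in increasing order, repeated according to multiplicity. Only the real roots of
  the characteristic polynomial are listed, which for a symmetric matrix are all of them.
\<close>

definition eigenvalue_list :: "real mat \<Rightarrow> real list" where
  "eigenvalue_list A = sorted_list_of_multiset (proots (char_poly A))"

definition second_smallest_eigenvalue :: "real mat \<Rightarrow> real" where
  "second_smallest_eigenvalue A = eigenvalue_list A ! 1"

definition second_largest_eigenvalue :: "real mat \<Rightarrow> real" where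
  "second_largest_eigenvalue A = rev (eigenvalue_list A) ! 1"

definition data_rank :: "nat \<Rightarrow> real vec \<Rightarrow> nat \<Rightarrow> real" where
  "data_rank n X k = 1 + (\<Sum>l<n. of_bool (X $ k > X $ l))"

definition trim_count :: "nat \<Rightarrow> real \<Rightarrow> nat" where
  "trim_count n \<alpha> = nat \<lfloor>\<alpha> * real n\<rfloor>"

definition trim_lo :: "nat \<Rightarrow> real \<Rightarrow> real" where
  "trim_lo n \<alpha> = real (trim_count n \<alpha>) + 1/2"

definition trim_hi :: "nat \<Rightarrow> real \<Rightarrow> real" where
  "trim_hi n \<alpha> = real n - real (trim_count n \<alpha>) + 1/2"

definition trim_const :: "nat \<Rightarrow> real \<Rightarrow> real" where
  "trim_const n \<alpha> = 1 - 2 * real (trim_count n \<alpha>) / real n"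

definition trim_weight :: "nat \<Rightarrow> real \<Rightarrow> real \<Rightarrow> real" where
  "trim_weight n \<alpha> r = indicator {trim_lo n \<alpha>..trim_hi n \<alpha>} r / trim_const n \<alpha>"

definition trimmed_mean :: "nat \<Rightarrow> real \<Rightarrow> real vec \<Rightarrow> real" where
  "trimmed_mean n \<alpha> X = 1 / real n * (\<Sum>k<n. trim_weight n \<alpha> (data_rank n X k) * X $ k)"

definition rank_gap :: "nat \<Rightarrow> real \<Rightarrow> real \<Rightarrow> real" where
  "rank_gap n \<alpha> r = min \<bar>r - trim_lo n \<alpha>\<bar> \<bar>r - trim_hi n \<alpha>\<bar>"

definition rank_sigma :: "nat \<Rightarrow> real \<Rightarrow> real" where
  "rank_sigma n r = (let u = (r - 1) / real n in real n powr (3/2) * sqrt (u * (1 - u)))"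

definition K_vec :: "nat \<Rightarrow> real \<Rightarrow> real vec \<Rightarrow> real vec" where
  "K_vec n \<alpha> X = vec n (\<lambda>i. let r = data_rank n X i
     in sqrt 6 * rank_sigma n r / (rank_gap n \<alpha> r * (1 - 2 * \<alpha>)))"

primrec swapped :: "nat \<Rightarrow> real vec \<Rightarrow> (nat \<Rightarrow> nat \<times> nat) \<Rightarrow> nat \<Rightarrow> real vec" where
  "swapped n X \<omega> 0 = X"
| "swapped n X \<omega> (Suc s) = swap_mat n (\<omega> (Suc s)) *\<^sub>v swapped n X \<omega> s"

definition rank_est :: "nat \<Rightarrow> real vec \<Rightarrow> (nat \<Rightarrow> nat \<times> nat) \<Rightarrow> nat \<Rightarrow> nat \<Rightarrow> real" where
  "rank_est n X \<omega> t k =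
     1 + real n / real t * (\<Sum>s=1..t. of_bool (X $ k > swapped n X \<omega> (s - 1) $ k))"

definition gotrim_weights ::
    "nat \<Rightarrow> real \<Rightarrow> real vec \<Rightarrow> (nat \<Rightarrow> nat \<times> nat) \<Rightarrow> nat \<Rightarrow> real vec" where
  "gotrim_weights n \<alpha> X \<omega> s =
     (if s = 0 then 0\<^sub>v n else vec n (\<lambda>k. trim_weight n \<alpha> (rank_est n X \<omega> s k)))"

definition gotrim ::
    "nat \<Rightarrow> real \<Rightarrow> real vec \<Rightarrow> (nat \<Rightarrow> nat \<times> nat) \<Rightarrow> nat \<Rightarrow> real vec" where
  "gotrim n \<alpha> X \<omega> t = vec n (\<lambda>k. \<Sum>s=1..t.
     (avg_prod n \<omega> s t *\<^sub>v
       component_mult (gotrim_weights n \<alpha> X \<omega> s - gotrim_weights n \<alpha> X \<omega> (s - 1)) X) $ k)"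

definition gotrim_error ::
    "nat \<Rightarrow> (nat \<times> nat) set \<Rightarrow> real \<Rightarrow> real vec \<Rightarrow> nat \<Rightarrow> real" where
  "gotrim_error n E \<alpha> X t = (\<integral>\<omega>. vec_norm2
     (gotrim n \<alpha> X \<omega> t - trimmed_mean n \<alpha> X \<cdot>\<^sub>v vec n (\<lambda>_. 1)) \<partial>edge_process n E)"

lemma degree_of_pos:
  assumes "graph_on n E" "connected_graph n E" "2 \<le> n" "k < n"
  shows "degree_of E k > 0"
proof -
  have fin: "finite E"
    using assms(1) unfolding graph_on_def
    by (rule finite_subset) (rule finite_subset[of _ "{..<n} \<times> {..<n}"], auto)
  obtain v where v: "v < n" "v \<noteq> k"
  proof (cases "k = 0")
    case True
    then show ?thesis using that[of 1] assms(3) by simp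
  next
    case False
    then show ?thesis using that[of 0] assms(3) by simp
  qed
  have "(k, v) \<in> (E \<union> E\<inverse>)\<^sup>*"
    using assms(2,4) v unfolding connected_graph_def by blast
  then obtain w where "(k, w) \<in> E \<union> E\<inverse>"
    using v by (metis converse_rtranclE)
  then have "{e \<in> E. fst e = k \<or> snd e = k} \<noteq> {}" by force
  then show ?thesis
    using fin unfolding degree_of_def by (simp add: card_gt_0_iff)
qed

lemma edge_prob_nonneg: "edge_prob n E e \<ge> 0"
  unfolding edge_prob_def by (simp split: prod.split)

lemma sum_edge_prob:
  assumes "graph_on n E" "connected_graph n E" "2 \<le> n"
  shows "(\<Sum>e\<in>E. edge_prob n E e) = 1"
proof -
  have fin: "finite E"
    using assms(1) unfolding graph_on_def
    by (rule finite_subset) (rule finite_subset[of _ "{..<n} \<times> {..<n}"], auto)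
  have "(\<Sum>e\<in>E. edge_prob n E e)
      = (\<Sum>e\<in>E. \<Sum>k<n. if fst e = k \<or> snd e = k then 1 / (real n * real (degree_of E k)) else 0)"
  proof (rule sum.cong)
    fix e assume e: "e \<in> E"
    obtain i j where ij: "e = (i, j)" by force
    have lt: "i < j" "j < n" using e ij assms(1) unfolding graph_on_def by auto
    have "(\<Sum>k<n. if i = k \<or> j = k then 1 / (real n * real (degree_of E k)) else 0)
        = (\<Sum>k\<in>{i, j}. 1 / (real n * real (degree_of E k)))"
      using lt by (intro sum.mono_neutral_cong_right) auto
    then show "edge_prob n E e = (\<Sum>k<n. if fst e = k \<or> snd e = k
        then 1 / (real n * real (degree_of E k)) else 0)"
      using lt ij unfolding edge_prob_def by (simp add: field_simps)
  qed simp
  also have "\<dots> = (\<Sum>k<n. \<Sum>e\<in>E. if fst e = k \<or> snd e = k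
      then 1 / (real n * real (degree_of E k)) else 0)"
    by (rule sum.swap)
  also have "\<dots> = (\<Sum>k<n. 1 / real n)"
  proof (rule sum.cong)
    fix k assume "k \<in> {..<n}"
    then have pos: "degree_of E k > 0" using degree_of_pos[OF assms] by simp
    have "(\<Sum>e\<in>E. if fst e = k \<or> snd e = k then 1 / (real n * real (degree_of E k)) else 0)
        = real (degree_of E k) * (1 / (real n * real (degree_of E k)))"
      using fin by (simp add: degree_of_def flip: sum.inter_filter)
    then show "(\<Sum>e\<in>E. if fst e = k \<or> snd e = k
        then 1 / (real n * real (degree_of E k)) else 0) = 1 / real n"
      using pos by simp
  qed simp
  also have "\<dots> = 1" using assms(3) by simp
  finally show ?thesis .
qed

text \<open>On the graphs of interest the density passed to \<open>embed_pmf\<close> is a genuine one.\<close>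

lemma pmf_edge_pmf:
  assumes "graph_on n E" "connected_graph n E" "2 \<le> n"
  shows "pmf (edge_pmf n E) e = (if e \<in> E then edge_prob n E e else 0)"
  unfolding edge_pmf_def
proof (rule pmf_embed_pmf)
  have fin: "finite E"
    using assms(1) unfolding graph_on_def
    by (rule finite_subset) (rule finite_subset[of _ "{..<n} \<times> {..<n}"], auto)
  have "(\<integral>\<^sup>+ e. ennreal (if e \<in> E then edge_prob n E e else 0) \<partial>count_space UNIV)
      = (\<Sum>e\<in>E. ennreal (edge_prob n E e))"
    using fin by (subst nn_integral_count_space'[of E]) auto
  also have "\<dots> = 1"
    using sum_edge_prob[OF assms] by (simp add: sum_ennreal edge_prob_nonneg)
  finally show "(\<integral>\<^sup>+ e. ennreal (if e \<in> E then edge_prob n E e else 0) \<partial>count_space UNIV) = 1" .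
qed (simp add: edge_prob_nonneg)

end

theory Submission
  imports Defs "Jordan_Normal_Form.Schur_Decomposition"
begin

text \<open>
  Since the threshold on \<open>t\<close> may depend on the graph and on the data, it is enough that the expected
  error is \<open>O(1/t)\<close> and that the constant multiplying \<open>1/\<surd>t\<close> on the right is positive; \<open>C\<^sub>0 = 1\<close> then
  works. Positivity needs \<open>c > 0\<close>, which is connectedness, and a non-minimal node with nonzero value,
  which exists because a non-bipartite graph has at least three nodes.

  The rank estimate of a node is an ergodic average of a function transported by random swaps. The mean
  swap contracts mean-zero vectors (a connected non-bipartite graph is not a star), so the variance of
  the rank estimate is \<open>O(1/t)\<close>. By Chebyshev's inequality each weight differs from its limit with
  probability \<open>O(1/t)\<close>. Averaging preserves the mean of the estimates and contracts the deviation from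
  it, while the increment injected at step \<open>t\<close> has expected size \<open>O(1/t)\<close> and depends only on earlier
  edges; hence the deviation is \<open>O(1/t)\<close> as well.
\<close>

text \<open>The rate \<open>1/t\<close> is better than the target \<open>1/sqrt t\<close> because
  the limit weights are locally constant at the true ranks: a weight error is then controlled by the
  second moment of the rank error and not by its square root. The contraction factors may be crude,
  since any \<open>q < 1\<close> will do; they come from a path argument in the graph, and the
  spectrum enters only through \<open>c > 0\<close> and the identity for \<open>lam\<close>. As
  eigenvalues are read off a sorted list of real roots, that list must be shown to have length
  \<open>n\<close> before its second entry means anything. Swapping and averaging use the same
  edges, so no independence between them is available; conditioning on the past replaces it. This
  stays elementary because each quantity at a finite time reads finitely many edges, so that
  conditioning is a finite sum over the next edge.\<close>

text \<open>The sequence \<open>t * a t\<close> obeys a recursion with factor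
  \<open>q * (t + 1) / t\<close>, which is eventually below a fixed number less than 1; the finitely
  many earlier terms go into the constant.\<close>

lemma geometric_reciprocal_bound:
  fixes a :: "nat \<Rightarrow> real"
  assumes q: "0 \<le> q" "q < 1" and C: "0 \<le> C"
    and step: "\<And>t. 1 \<le> t \<Longrightarrow> a (Suc t) \<le> q * (a t + C / real (Suc t))"
  obtains M where "\<And>t. 1 \<le> t \<Longrightarrow> a t \<le> M / real t"
proof -
  \<comment> \<open>Any number strictly between \<open>q\<close> and 1 would do; the slack
    \<open>r - q\<close> absorbs the ratio \<open>(t + 1) / t\<close> once \<open>t\<close> exceeds
    \<open>q / (r - q)\<close>.\<close>
  define r where "r = (1 + q) / 2"
  have r: "q < r" "r < 1" "0 < r" using q by (auto simp: r_def)
  obtain t0 :: nat where t0: "q / (r - q) < real t0" using reals_Archimedean2 by blast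
  define t1 where "t1 = Suc t0"
  \<comment> \<open>\<open>q * C / (1 - r)\<close> is the fixed point of
    \<open>y = r * y + q * C\<close>, so a bound at least this large reproduces itself.\<close>
  define M where "M = Max (insert (q * C / (1 - r)) ((\<lambda>t. real t * a t) ` {..t1}))"
  have M1: "real t * a t \<le> M" if "t \<le> t1" for t unfolding M_def using that by (intro Max_ge) auto
  have M2: "q * C / (1 - r) \<le> M" unfolding M_def by (intro Max_ge) auto
  have "0 \<le> q * C / (1 - r)" using q C r by simp
  with M2 have M0: "0 \<le> M" by linarith
  have big: "real t * a t \<le> M" if "t1 \<le> t" for t
    using that
  proof (induction t rule: dec_induct)
    case base
    then show ?case using M1 by simp
  next
    case (step t)
    have t: "1 \<le> t" "real t0 < real t" using step by (auto simp: t1_def)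
    have "q / (r - q) < real t" using t t0 by linarith
    then have qr: "q * real (Suc t) \<le> r * real t" using r t by (simp add: field_simps)
    have "real (Suc t) * a (Suc t) \<le> real (Suc t) * (q * (a t + C / real (Suc t)))"
      using assms(4)[OF t(1)] by (intro mult_left_mono) auto
    also have "\<dots> = q * real (Suc t) * a t + q * C" by (simp add: field_simps)
    also have "\<dots> = (q * real (Suc t) / real t) * (real t * a t) + q * C" using t by simp
    also have "\<dots> \<le> (q * real (Suc t) / real t) * M + q * C"
      using step.IH q by (intro add_right_mono mult_left_mono) auto
    also have "\<dots> \<le> r * M + q * C"
      using qr t M0 by (intro add_right_mono mult_right_mono) (auto simp: field_simps)
    also have "\<dots> \<le> M" using M2 r by (simp add: field_simps)
    finally show ?case .
  qed
  show ?thesis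
  proof (rule that[of M])
    fix t :: nat assume "1 \<le> t"
    then show "a t \<le> M / real t"
      using M1[of t] big[of t] by (cases "t \<le> t1") (auto simp: field_simps)
  qed
qed

section \<open>Spectrum of the mean Laplacian\<close>

locale sampled_graph =
  fixes n :: nat and E :: "(nat \<times> nat) set"
  assumes n_ge_2: "2 \<le> n"
    and graph: "graph_on n E"
    and connected: "connected_graph n E"
    and nonbip: "\<not> bipartite_graph n E"
begin

abbreviation prb :: "nat \<times> nat \<Rightarrow> real" where
  "prb \<equiv> edge_prob n E"

lemma edge_less: "e \<in> E \<Longrightarrow> fst e < snd e" "e \<in> E \<Longrightarrow> fst e < n" "e \<in> E \<Longrightarrow> snd e < n"
  using graph unfolding graph_on_def by fastforce+

lemma finite_edges: "finite E"
  by (rule finite_subset[of _ "{..<n} \<times> {..<n}"]) (use edge_less in \<open>auto simp: mem_Times_iff\<close>)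

lemma edges_nonempty: "E \<noteq> {}"
proof
  assume "E = {}"
  then have "bipartite_graph n E"
    unfolding bipartite_graph_def by (intro exI[of _ "{..<n}"] exI[of _ "{}"]) auto
  then show False using nonbip by simp
qed

lemma prb_pos: "e \<in> E \<Longrightarrow> prb e > 0"
  using degree_of_pos[OF graph connected n_ge_2] edge_less[of e] n_ge_2
  by (auto simp: edge_prob_def split: prod.split intro!: add_pos_pos mult_pos_pos divide_pos_pos)

lemma sum_prb: "(\<Sum>e\<in>E. prb e) = 1"
  by (rule sum_edge_prob[OF graph connected n_ge_2])

lemma n_ge_3: "3 \<le> n"
proof (rule ccontr)
  assume "\<not> 3 \<le> n"
  then have n: "n = 2" using n_ge_2 by simp
  have "\<forall>(i, j)\<in>E. i \<in> {0} \<and> j \<in> {1}"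
    using edge_less n by fastforce
  then have "bipartite_graph n E"
    unfolding bipartite_graph_def n
    by (intro exI[of _ "{0}"] exI[of _ "{1::nat}"]) auto
  then show False using nonbip by simp
qed

text \<open>Otherwise the graph would be a star centred at \<open>i\<close>, hence bipartite.\<close>

lemma edge_avoiding:
  assumes "i < n"
  obtains f where "f \<in> E" "fst f \<noteq> i" "snd f \<noteq> i"
proof -
  have "\<exists>f\<in>E. fst f \<noteq> i \<and> snd f \<noteq> i"
  proof (rule ccontr)
    assume *: "\<not> ?thesis"
    have "\<forall>(u, v)\<in>E. (u \<in> {i} \<and> v \<in> {..<n} - {i}) \<or> (u \<in> {..<n} - {i} \<and> v \<in> {i})"
      using * edge_less by fastforce
    then have "bipartite_graph n E"
      unfolding bipartite_graph_def using assms
      by (intro exI[of _ "{i}"] exI[of _ "{..<n} - {i}"]) auto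
    then show False using nonbip by simp
  qed
  then show ?thesis using that by blast
qed

lemma constant_on_edges:
  assumes "\<And>e. e \<in> E \<Longrightarrow> x (fst e) = x (snd e)" "u < n" "v < n"
  shows "x u = x v"
proof -
  have "(u, v) \<in> (E \<union> E\<inverse>)\<^sup>*"
    using connected assms unfolding connected_graph_def by blast
  then show ?thesis
    by (induction rule: rtrancl_induct) (use assms(1) in force)+
qed

section \<open>The Laplacian as a quadratic form\<close>

lemma mean_laplacian_carrier [simp]: "mean_laplacian n E \<in> carrier_mat n n"
  by (simp add: mean_laplacian_def)

lemma edge_laplacian_index:
  assumes "e \<in> E" "k < n" "l < n"
  shows "edge_laplacian n e $$ (k, l) =
    (of_bool (k = fst e) - of_bool (k = snd e)) * (of_bool (l = fst e) - of_bool (l = snd e))"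
  using assms edge_less[of e] by (auto simp: edge_laplacian_def case_prod_unfold Let_def)

text \<open>The general field serves two uses: real vectors for the kernel, complex ones for
  eigenvectors that are not yet known to be real.\<close>

lemma mean_laplacian_mult_vec:
  fixes v :: "'a :: real_field vec"
  assumes v: "v \<in> carrier_vec n" and k: "k < n"
  shows "(map_mat of_real (mean_laplacian n E) *\<^sub>v v) $ k =
    (\<Sum>e\<in>E. of_real (prb e) * ((of_bool (k = fst e) - of_bool (k = snd e)) * (v $ fst e - v $ snd e)))"
proof -
  have "(map_mat of_real (mean_laplacian n E) *\<^sub>v v) $ k =
      (\<Sum>l<n. of_real (\<Sum>e\<in>E. prb e * edge_laplacian n e $$ (k, l)) * v $ l)"
    using v k by (simp add: mean_laplacian_def scalar_prod_def atLeast0LessThan)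
  also have "\<dots> = (\<Sum>l<n. \<Sum>e\<in>E. of_real (prb e) * of_real (edge_laplacian n e $$ (k, l)) * v $ l)"
    by (simp add: sum_distrib_right)
  also have "\<dots> = (\<Sum>e\<in>E. \<Sum>l<n. of_real (prb e) * of_real (edge_laplacian n e $$ (k, l)) * v $ l)"
    by (rule sum.swap)
  also have "\<dots> = (\<Sum>e\<in>E. of_real (prb e) * ((of_bool (k = fst e) - of_bool (k = snd e)) * (v $ fst e - v $ snd e)))"
  proof (rule sum.cong)
    fix e assume e: "e \<in> E"
    have "(\<Sum>l<n. of_real (prb e) * of_real (edge_laplacian n e $$ (k, l)) * v $ l)
       = (\<Sum>l<n. of_real (prb e) * (of_bool (k = fst e) - of_bool (k = snd e)) *
           ((if l = fst e then v $ l else 0) - (if l = snd e then v $ l else 0)))"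
      by (rule sum.cong) (auto simp: edge_laplacian_index[OF e k])
    also have "\<dots> = of_real (prb e) * (of_bool (k = fst e) - of_bool (k = snd e)) * (v $ fst e - v $ snd e)"
      using edge_less[OF e] by (simp add: sum_subtractf flip: sum_distrib_left)
    finally show "(\<Sum>l<n. of_real (prb e) * of_real (edge_laplacian n e $$ (k, l)) * v $ l)
       = of_real (prb e) * ((of_bool (k = fst e) - of_bool (k = snd e)) * (v $ fst e - v $ snd e))"
      by (simp add: mult.assoc)
  qed simp
  finally show ?thesis .
qed

text \<open>This is summation by parts. The right side is symmetric in \<open>v\<close> and
  \<open>w\<close>, which supplies the self-adjointness used below. No conjugation is built in; over
  the complex numbers it is put into \<open>w\<close>.\<close>

lemma laplacian_form:
  fixes v w :: "'a :: real_field vec"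
  assumes v: "v \<in> carrier_vec n"
  shows "(\<Sum>k<n. w $ k * (map_mat of_real (mean_laplacian n E) *\<^sub>v v) $ k) =
    (\<Sum>e\<in>E. of_real (prb e) * ((w $ fst e - w $ snd e) * (v $ fst e - v $ snd e)))"
proof -
  have "(\<Sum>k<n. w $ k * (map_mat of_real (mean_laplacian n E) *\<^sub>v v) $ k) =
    (\<Sum>k<n. \<Sum>e\<in>E. of_real (prb e) * (v $ fst e - v $ snd e) *
        ((if k = fst e then w $ k else 0) - (if k = snd e then w $ k else 0)))"
    using v by (auto simp: mean_laplacian_mult_vec sum_distrib_left intro!: sum.cong)
  also have "\<dots> = (\<Sum>e\<in>E. \<Sum>k<n. of_real (prb e) * (v $ fst e - v $ snd e) *
        ((if k = fst e then w $ k else 0) - (if k = snd e then w $ k else 0)))"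
    by (rule sum.swap)
  also have "\<dots> = (\<Sum>e\<in>E. of_real (prb e) * (v $ fst e - v $ snd e) * (w $ fst e - w $ snd e))"
    using edge_less by (intro sum.cong) (auto simp: sum_subtractf simp flip: sum_distrib_left)
  finally show ?thesis by (simp add: mult_ac)
qed

text \<open>The form at \<open>w = v\<close> is a sum of nonnegative terms, so a kernel vector
  agrees at both ends of every edge, and connectedness does the rest.\<close>

lemma mean_laplacian_null:
  assumes v: "v \<in> carrier_vec n" and null: "mean_laplacian n E *\<^sub>v v = 0\<^sub>v n" and "i < n" "j < n"
  shows "v $ i = v $ j"
proof -
  have "map_mat of_real (mean_laplacian n E) = mean_laplacian n E" by auto
  then have "0 = (\<Sum>e\<in>E. prb e * ((v $ fst e - v $ snd e) * (v $ fst e - v $ snd e)))"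
    using laplacian_form[OF v, of v] null by simp
  then have "\<forall>e\<in>E. prb e * ((v $ fst e - v $ snd e) * (v $ fst e - v $ snd e)) = 0"
    by (subst (asm) eq_commute, subst (asm) sum_nonneg_eq_0_iff)
      (auto simp: finite_edges edge_prob_nonneg)
  then have "v $ fst e = v $ snd e" if "e \<in> E" for e
    using prb_pos[OF that] that by force
  then show ?thesis by (rule constant_on_edges[of "vec_index v"]) (use assms in auto)
qed

text \<open>By symmetry the squared norm of \<open>L v\<close> is the pairing of \<open>v\<close>
  with \<open>L (L v)\<close>, so \<open>L v = 0\<close>. This excludes a Jordan block at 0 without
  diagonalising the matrix.\<close>

lemma mean_laplacian_square_null:
  assumes v: "v \<in> carrier_vec n"
    and null: "mean_laplacian n E *\<^sub>v (mean_laplacian n E *\<^sub>v v) = 0\<^sub>v n" and "i < n" "j < n"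
  shows "v $ i = v $ j"
proof -
  define w where "w = mean_laplacian n E *\<^sub>v v"
  have w: "w \<in> carrier_vec n"
    unfolding w_def using mult_mat_vec_carrier[OF mean_laplacian_carrier v] .
  have L: "map_mat of_real (mean_laplacian n E) = mean_laplacian n E" by auto
  have "(\<Sum>k<n. w $ k * w $ k) = (\<Sum>k<n. v $ k * (mean_laplacian n E *\<^sub>v w) $ k)"
    using laplacian_form[OF v, of w] laplacian_form[OF w, of v] unfolding L
    by (simp add: w_def mult_ac)
  also have "\<dots> = 0" using null by (simp add: w_def)
  finally have "\<forall>k<n. w $ k = 0"
    by (subst (asm) sum_nonneg_eq_0_iff) auto
  then have "w = 0\<^sub>v n" using w by (intro eq_vecI) auto
  then show ?thesis using mean_laplacian_null[OF v] assms(3,4) unfolding w_def by blast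
qed

text \<open>Pairing an eigenvector with its conjugate writes the eigenvalue as the Rayleigh quotient
  \<open>T / S\<close> of two nonnegative reals.\<close>

lemma complex_eigenvalue:
  assumes "eigenvalue (map_mat complex_of_real (mean_laplacian n E)) a"
  shows "a = of_real (Re a)" "0 \<le> Re a"
proof -
  obtain v where v: "v \<in> carrier_vec n" "v \<noteq> 0\<^sub>v n"
    and ev: "map_mat complex_of_real (mean_laplacian n E) *\<^sub>v v = a \<cdot>\<^sub>v v"
    using assms unfolding eigenvalue_def eigenvector_def by (auto simp: mean_laplacian_def)
  define S where "S = (\<Sum>k<n. (cmod (v $ k))\<^sup>2)"
  define T where "T = (\<Sum>e\<in>E. prb e * (cmod (v $ fst e - v $ snd e))\<^sup>2)"
  have "a * of_real S = (\<Sum>k<n. conjugate v $ k * (a \<cdot>\<^sub>v v) $ k)"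
    using v(1) by (auto simp: S_def sum_distrib_left complex_norm_square mult_ac simp del: of_real_power intro!: sum.cong)
  also have "\<dots> = (\<Sum>e\<in>E. of_real (prb e) *
      ((conjugate v $ fst e - conjugate v $ snd e) * (v $ fst e - v $ snd e)))"
    unfolding ev[symmetric] by (rule laplacian_form) fact
  also have "\<dots> = of_real T"
    using v(1) edge_less
    by (auto simp: T_def complex_norm_square mult_ac simp del: of_real_power intro!: sum.cong)
  finally have eq: "a * of_real S = of_real T" .
  obtain k where k: "k < n" "v $ k \<noteq> 0"
    using v by (metis eq_vecI carrier_vecD index_zero_vec)
  then have S: "S > 0"
    unfolding S_def by (intro sum_pos2[of _ k]) auto
  have T: "T \<ge> 0" unfolding T_def by (auto intro!: sum_nonneg simp: edge_prob_nonneg)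
  have a: "a = of_real (T / S)" using eq S by (simp add: field_simps)
  then show "a = of_real (Re a)" by simp
  show "0 \<le> Re a" using S T by (simp add: a)
qed

lemma proots_prod_linear: "proots (\<Prod>b\<leftarrow>bs. [:- b, 1:]) = mset (bs :: real list)"
proof (induction bs)
  case (Cons b bs)
  have "(\<Prod>b\<leftarrow>bs. [:- b, 1:]) \<noteq> 0" by (auto simp: prod_list_zero_iff)
  then show ?case
    using Cons proots_mult[of "[:- b, 1:]" "\<Prod>b\<leftarrow>bs. [:- b, 1:]"] by (simp del: mult_pCons_left)
qed simp

text \<open>\<open>eigenvalue_list\<close> sees only real roots and could a priori be too short. The
  complex factorisation has \<open>n\<close> linear factors, all of them real by the Rayleigh
  quotient, so it descends to a real factorisation.\<close>

lemma char_poly_mean_laplacian: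
  fixes es defines "es \<equiv> eigenvalue_list (mean_laplacian n E)"
  shows "char_poly (mean_laplacian n E) = (\<Prod>b\<leftarrow>es. [:- b, 1:])"
    and "length es = n" and "sorted es" and "\<And>b. b \<in> set es \<Longrightarrow> 0 \<le> b"
proof -
  let ?L = "mean_laplacian n E" let ?C = "map_mat complex_of_real ?L"
  have C: "?C \<in> carrier_mat n n" by simp
  from char_poly_factorized[OF C] obtain as
    where as: "char_poly ?C = (\<Prod>a\<leftarrow>as. [:- a, 1:])" "length as = n" by blast
  have a: "a = of_real (Re a) \<and> 0 \<le> Re a" if "a \<in> set as" for a
  proof -
    have "poly (char_poly ?C) a = 0"
      unfolding as using that by (force simp: poly_prod_list prod_list_zero_iff)
    then have "eigenvalue ?C a" using eigenvalue_root_char_poly[OF C] by simp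
    then show ?thesis using complex_eigenvalue by blast
  qed
  define bs where "bs = map Re as"
  have "map_poly complex_of_real (char_poly ?L) = (\<Prod>a\<leftarrow>as. [:- a, 1:])"
    using of_real_hom.char_poly_hom[of ?L n, where ?'a = complex] as by simp
  also have "\<dots> = (\<Prod>a\<leftarrow>as. map_poly complex_of_real [:- Re a, 1:])"
    using a by (intro arg_cong[of _ _ prod_list] map_cong) (auto simp: map_poly_pCons)
  also have "\<dots> = map_poly complex_of_real (\<Prod>b\<leftarrow>bs. [:- b, 1:])"
    unfolding bs_def
  proof (induction as)
    case (Cons a as)
    interpret map_poly_comm_ring_hom complex_of_real ..
    show ?case
      using Cons by (simp del: mult_pCons_left add: hom_mult)
  qed simp
  finally have cp: "char_poly ?L = (\<Prod>b\<leftarrow>bs. [:- b, 1:])"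
    by (auto simp: poly_eq_iff coeff_map_poly)
  have es: "es = sort bs"
    unfolding es_def eigenvalue_list_def cp proots_prod_linear by simp
  have "prod_list (map (\<lambda>b. [:- b, 1:]) es) = prod_list (map (\<lambda>b. [:- b, 1:]) bs)"
    unfolding prod_mset_prod_list[symmetric] mset_map es by simp
  then show "char_poly ?L = (\<Prod>b\<leftarrow>es. [:- b, 1:])" using cp by simp
  show "length es = n" "sorted es" using as(2) by (simp_all add: es bs_def)
  show "0 \<le> b" if "b \<in> set es" for b using that a by (auto simp: es bs_def)
qed

text \<open>
  A double zero of the characteristic polynomial would make the first two Schur vectors solutions of
  \<open>L\<^sup>2 v = 0\<close>. As \<open>L\<close> is symmetric with the constants as its kernel, both would be constant, yet they are
  linearly independent.
\<close>

lemma second_smallest_eigenvalue_pos: "second_smallest_eigenvalue (mean_laplacian n E) > 0"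
proof (rule ccontr)
  let ?L = "mean_laplacian n E"
  define es where "es = eigenvalue_list ?L"
  note es = char_poly_mean_laplacian[folded es_def]
  assume "\<not> ?thesis"
  then have "es ! 1 \<le> 0" by (simp add: second_smallest_eigenvalue_def es_def)
  moreover have "es ! 0 \<le> es ! 1" using es(2,3) n_ge_2 by (simp add: sorted_nth_mono)
  moreover have "0 \<le> es ! 0" "0 \<le> es ! 1" using es(2,4) n_ge_2 by auto
  ultimately have z: "es ! 0 = 0" "es ! 1 = 0" by linarith+
  obtain B P Q where sch: "schur_decomposition ?L es = (B, P, Q)" by (metis prod_cases3)
  from schur_decomposition[OF mean_laplacian_carrier es(1) sch]
  have wit: "similar_mat_wit ?L B P Q" and ut: "upper_triangular B" and diag: "diag_mat B = es"
    by auto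
  note W = similar_mat_witD2[OF mean_laplacian_carrier wit]
  note [simp] = W(5,6,7)
  have LP: "?L * P = P * B"
    using W by (metis assoc_mult_mat mult_carrier_mat right_mult_one_mat)
  have dB: "B $$ (i, i) = es ! i" if "i < n" for i
    using that carrier_matD[OF W(5)] unfolding diag[symmetric] diag_mat_def by simp
  have Bz: "B $$ (i, j) = 0" if "j < i" "i < n" for i j
    using ut that W(5) unfolding upper_triangular_def by auto
  \<comment> \<open>Under the double zero, this is the only entry in the first two columns of
    \<open>B\<close> that can be nonzero; hence \<open>p\<close> is in the kernel and
    \<open>q\<close> is sent to a multiple of \<open>p\<close>.\<close>
  define b where "b = B $$ (0, 1)"
  have B0: "B *\<^sub>v unit_vec n 0 = 0\<^sub>v n"
  proof (rule eq_vecI)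
    fix i assume "i < dim_vec (0\<^sub>v n :: real vec)"
    then have i: "i < n" by simp
    have "(B *\<^sub>v unit_vec n 0) $ i = B $$ (i, 0)"
      using i n_ge_2 carrier_matD[OF W(5)] by simp
    then show "(B *\<^sub>v unit_vec n 0) $ i = 0\<^sub>v n $ i"
      using Bz[of 0 i] dB[of 0] z i by (cases "i = 0") auto
  qed (use carrier_matD[OF W(5)] in simp)
  have B1: "B *\<^sub>v unit_vec n 1 = b \<cdot>\<^sub>v unit_vec n 0"
  proof (rule eq_vecI)
    fix i assume "i < dim_vec (b \<cdot>\<^sub>v unit_vec n 0 :: real vec)"
    then have i: "i < n" by simp
    have "(B *\<^sub>v unit_vec n 1) $ i = B $$ (i, 1)"
      using i n_ge_2 carrier_matD[OF W(5)] by simp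
    then show "(B *\<^sub>v unit_vec n 1) $ i = (b \<cdot>\<^sub>v unit_vec n 0) $ i"
      using Bz[of 1 i] dB[of 1] z i n_ge_2
      by (cases "i = 0"; cases "i = 1") (auto simp: b_def)
  qed (use carrier_matD[OF W(5)] in simp)
  define p q where "p = P *\<^sub>v unit_vec n 0" and "q = P *\<^sub>v unit_vec n 1"
  have pq: "p \<in> carrier_vec n" "q \<in> carrier_vec n"
    using W(6) by (auto simp: p_def q_def intro!: mult_mat_vec_carrier[of _ _ n])
  have Lp: "?L *\<^sub>v p = 0\<^sub>v n"
  proof -
    have "?L *\<^sub>v p = P *\<^sub>v (B *\<^sub>v unit_vec n 0)"
      unfolding p_def using LP by (metis W(5,6) assoc_mult_mat_vec mean_laplacian_carrier unit_vec_carrier)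
    then show ?thesis
      unfolding B0 by (intro eq_vecI) (simp_all add: carrier_matD[OF W(6)] scalar_prod_def)
  qed
  have Lq: "?L *\<^sub>v q = b \<cdot>\<^sub>v p"
  proof -
    have "?L *\<^sub>v q = P *\<^sub>v (B *\<^sub>v unit_vec n 1)"
      unfolding q_def using LP by (metis W(5,6) assoc_mult_mat_vec mean_laplacian_carrier unit_vec_carrier)
    then show ?thesis unfolding B1 p_def using W(6) by (metis mult_mat_vec unit_vec_carrier)
  qed
  have LLq: "?L *\<^sub>v (?L *\<^sub>v q) = 0\<^sub>v n"
    unfolding Lq using Lp pq by (subst mult_mat_vec[OF mean_laplacian_carrier]) auto
  have pc: "p = (p $ 0) \<cdot>\<^sub>v vec n (\<lambda>_. 1)" "q = (q $ 0) \<cdot>\<^sub>v vec n (\<lambda>_. 1)"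
    using pq n_ge_2 mean_laplacian_null[OF pq(1) Lp, of 0] mean_laplacian_square_null[OF pq(2) LLq, of 0]
    by (auto intro!: eq_vecI)
  have "(q $ 0) \<cdot>\<^sub>v p = (p $ 0) \<cdot>\<^sub>v q"
    by (metis pc mult.commute smult_smult_assoc)
  moreover have Qp: "Q *\<^sub>v p = unit_vec n 0" "Q *\<^sub>v q = unit_vec n 1"
    unfolding p_def q_def using W
    by (metis assoc_mult_mat_vec one_mult_mat_vec unit_vec_carrier)+
  \<comment> \<open>Two multiples of the all-ones vector are dependent; applying \<open>Q\<close>
    moves the dependence to two unit vectors, where reading coordinate 1 gives
    \<open>p $ 0 = 0\<close>.\<close>
  ultimately have "(q $ 0) \<cdot>\<^sub>v unit_vec n 0 = (p $ 0) \<cdot>\<^sub>v (unit_vec n 1 :: real vec)"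
    by (metis W(7) mult_mat_vec pq)
  from arg_cong[OF this, of "\<lambda>v. v $ 1"] have "p $ 0 = 0"
    using n_ge_2 by simp
  then have "p = 0\<^sub>v n" using pc(1) by auto
  then have "(unit_vec n 0 :: real vec) = 0\<^sub>v n"

    unfolding Qp(1)[symmetric] by (intro eq_vecI) (simp_all add: carrier_matD[OF W(7)] scalar_prod_def)
  from arg_cong[OF this, of "\<lambda>v. v $ 0"] show False using n_ge_2 by simp
qed

text \<open>A Schur form \<open>B\<close> of the Laplacian also triangularises the averaging matrix,
  as \<open>1 - B / 2\<close>. The map from \<open>x\<close> to \<open>1 - x / 2\<close> is
  decreasing, whence the reversal.\<close>

lemma eigenvalue_list_mean_avg_mat:
  "eigenvalue_list (mean_avg_mat n E) = rev (map (\<lambda>x. 1 - x / 2) (eigenvalue_list (mean_laplacian n E)))"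
proof -
  let ?L = "mean_laplacian n E"
  define es where "es = eigenvalue_list ?L"
  note es = char_poly_mean_laplacian[folded es_def]
  obtain B P Q where sch: "schur_decomposition ?L es = (B, P, Q)" by (metis prod_cases3)
  from schur_decomposition[OF mean_laplacian_carrier es(1) sch]
  have wit: "similar_mat_wit ?L B P Q" and ut: "upper_triangular B" and diag: "diag_mat B = es"
    by auto
  note W = similar_mat_witD2[OF mean_laplacian_carrier wit]
  let ?M = "1\<^sub>m n - (1/2) \<cdot>\<^sub>m B"
  have "mean_avg_mat n E = P * ?M * Q"
  proof -
    have "P * ?M * Q = (P * 1\<^sub>m n - P * ((1/2) \<cdot>\<^sub>m B)) * Q"
      using W(5,6) by (subst mult_minus_distrib_mat[of _ n n _ n]) auto
    also have "\<dots> = P * 1\<^sub>m n * Q - P * ((1/2) \<cdot>\<^sub>m B) * Q"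
      using W(5,6,7) by (subst minus_mult_distrib_mat[of _ n n _ _ n]) auto
    also have "\<dots> = 1\<^sub>m n - (1/2) \<cdot>\<^sub>m (P * B * Q)"
      using W(1,5,6,7) by (simp add: mult_smult_distrib[of _ n n _ n] mult_smult_assoc_mat[of _ n n _ n])
    finally show ?thesis using W(3) by (simp add: mean_avg_mat_def)
  qed
  then have "similar_mat (mean_avg_mat n E) ?M"
    using W by (intro similar_matI[of _ _ P Q n]) (auto simp: mean_avg_mat_def)
  then have "char_poly (mean_avg_mat n E) = char_poly ?M" by (rule char_poly_similar)
  also have "\<dots> = (\<Prod>a\<leftarrow>diag_mat ?M. [:- a, 1:])"
    using ut W(5) by (intro char_poly_upper_triangular[of _ n]) (auto simp: upper_triangular_def)
  also have "diag_mat ?M = map (\<lambda>x. 1 - x / 2) es"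
    using W(5) by (auto simp: diag_mat_def simp flip: diag)
  finally have "eigenvalue_list (mean_avg_mat n E) = sort (map (\<lambda>x. 1 - x / 2) es)"
    unfolding eigenvalue_list_def by (simp only: proots_prod_linear sorted_list_of_multiset_mset)
  also have "\<dots> = rev (map (\<lambda>x. 1 - x / 2) es)"
  proof (rule properties_for_sort)
    show "sorted (rev (map (\<lambda>x. 1 - x / 2) es))"
      using es(3) by (simp add: sorted_wrt_rev sorted_wrt_map)
  qed simp
  finally show ?thesis by (simp add: es_def)
qed

lemma second_largest_eigenvalue_mean_avg_mat:
  "second_largest_eigenvalue (mean_avg_mat n E) = 1 - second_smallest_eigenvalue (mean_laplacian n E) / 2"
  using n_ge_2 char_poly_mean_laplacian(2)
  by (simp add: second_largest_eigenvalue_def second_smallest_eigenvalue_def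
      eigenvalue_list_mean_avg_mat)

section \<open>Expectations over the edge process\<close>

abbreviation expec :: "((nat \<Rightarrow> nat \<times> nat) \<Rightarrow> real) \<Rightarrow> real" where
  "expec f \<equiv> \<integral>\<omega>. f \<omega> \<partial>edge_process n E"

text \<open>The sample space contains sequences of arbitrary pairs, on which the matrices need not
  act as swaps or averages. Pathwise identities are therefore stated on this event of full
  measure.\<close>

definition edge_path :: "(nat \<Rightarrow> nat \<times> nat) \<Rightarrow> bool" where
  "edge_path \<omega> \<longleftrightarrow> (\<forall>s\<ge>1. \<omega> s \<in> E)"

text \<open>Adaptedness to the first \<open>t\<close> edges, stated for functions instead of
  sigma-algebras. As edges range over a countable type and \<open>E\<close> is finite, it already
  yields measurability and integrability.\<close>

definition determined :: "nat \<Rightarrow> ((nat \<Rightarrow> nat \<times> nat) \<Rightarrow> 'a) \<Rightarrow> bool" where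
  "determined t f \<longleftrightarrow> (\<forall>\<omega> \<omega>'. (\<forall>s\<in>{1..t}. \<omega> s = \<omega>' s) \<longrightarrow> f \<omega> = f \<omega>')"

lemma determinedD: "determined t f \<Longrightarrow> (\<And>s. 1 \<le> s \<Longrightarrow> s \<le> t \<Longrightarrow> \<omega> s = \<omega>' s) \<Longrightarrow> f \<omega> = f \<omega>'"
  unfolding determined_def by fastforce

lemma determined_mono: "determined s f \<Longrightarrow> s \<le> t \<Longrightarrow> determined t f"
  unfolding determined_def by fastforce

lemma determined_compose: "determined t f \<Longrightarrow> determined t (\<lambda>\<omega>. h (f \<omega>))"
  unfolding determined_def by metis

lemma determined_compose2: "determined t f \<Longrightarrow> determined t g \<Longrightarrow> determined t (\<lambda>\<omega>. h (f \<omega>) (g \<omega>))"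
  unfolding determined_def by metis

lemma determined_mult: "determined t f \<Longrightarrow> determined t g \<Longrightarrow> determined t (\<lambda>\<omega>. f \<omega> * g \<omega> :: real)"
  by (rule determined_compose2[where h = "(*)"])

lemma determined_add: "determined t f \<Longrightarrow> determined t g \<Longrightarrow> determined t (\<lambda>\<omega>. f \<omega> + g \<omega> :: real)"
  by (rule determined_compose2[where h = "(+)"])

lemma determined_diff: "determined t f \<Longrightarrow> determined t g \<Longrightarrow> determined t (\<lambda>\<omega>. f \<omega> - g \<omega> :: real)"
  by (rule determined_compose2[where h = "(-)"])

lemma determined_const: "determined t (\<lambda>_. c)"
  unfolding determined_def by simp

lemma determined_sum: "(\<And>i. i \<in> I \<Longrightarrow> determined t (f i)) \<Longrightarrow> determined t (\<lambda>\<omega>. \<Sum>i\<in>I. f i \<omega>)"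
  unfolding determined_def by (meson sum.cong)

lemma determined_upd: "determined t f \<Longrightarrow> determined t (\<lambda>\<omega>. f (\<omega> (i := e)))"
  unfolding determined_def by simp

lemma edge_path_AE: "AE \<omega> in edge_process n E. edge_path \<omega>"
proof -
  have set: "set_pmf (edge_pmf n E) \<subseteq> E"
    by (auto simp: set_pmf_iff pmf_edge_pmf[OF graph connected n_ge_2] split: if_splits)
  have "AE \<omega> in edge_process n E. \<omega> s \<in> E" if "s \<in> {1..}" for s
    unfolding edge_process_def
    by (rule AE_PiM_component) (use that set in \<open>auto intro: prob_space_measure_pmf simp: AE_measure_pmf_iff\<close>)
  then have "AE \<omega> in edge_process n E. s \<ge> 1 \<longrightarrow> \<omega> s \<in> E" for s
    by (cases "s \<ge> 1") auto
  then show ?thesis unfolding edge_path_def by (simp add: AE_all_countable)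
qed

lemma prob_space_edge_process: "prob_space (edge_process n E)"
  unfolding edge_process_def by (intro prob_space_PiM prob_space_measure_pmf)

text \<open>Freezing edge \<open>t + 1\<close> leaves a function of the first \<open>t\<close>
  edges, and there are only countably many values at which to freeze it.\<close>

lemma determined_measurable:
  fixes f :: "(nat \<Rightarrow> nat \<times> nat) \<Rightarrow> real"
  assumes "determined t f"
  shows "f \<in> borel_measurable (edge_process n E)"
  using assms
proof (induction t arbitrary: f)
  case 0
  have "f = (\<lambda>_. f undefined)" by (rule ext, rule determinedD[OF 0]) simp
  then show ?case using borel_measurable_const by metis
next
  case (Suc t)
  have "determined t (\<lambda>\<omega>. f (\<omega> (Suc t := e)))" for e
    unfolding determined_def by (intro allI impI determinedD[OF Suc.prems]) (auto simp: le_Suc_eq)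
  then have "(\<lambda>\<omega>. f (\<omega> (Suc t := e))) \<in> borel_measurable (edge_process n E)" for e
    by (rule Suc.IH)
  moreover have "(\<lambda>\<omega>. \<omega> (Suc t)) \<in> edge_process n E \<rightarrow>\<^sub>M count_space UNIV"
    using measurable_component_singleton[of "Suc t" "{1..}" "\<lambda>_. measure_pmf (edge_pmf n E)"]
    by (simp add: edge_process_def)
  ultimately have "(\<lambda>\<omega>. f (\<omega> (Suc t := \<omega> (Suc t)))) \<in> borel_measurable (edge_process n E)"
    by (rule measurable_compose_countable)
  then show ?case by simp
qed

text \<open>Edge paths have only finitely many restrictions to the first \<open>t\<close>
  times.\<close>

lemma determined_bounded:
  fixes f :: "(nat \<Rightarrow> nat \<times> nat) \<Rightarrow> real"
  assumes "determined t f"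
  obtains B where "\<And>\<omega>. edge_path \<omega> \<Longrightarrow> \<bar>f \<omega>\<bar> \<le> B"
proof -
  let ?S = "(\<lambda>\<omega>. \<bar>f \<omega>\<bar>) ` ({1..t} \<rightarrow>\<^sub>E E)"
  have fin: "finite ?S" by (intro finite_imageI finite_PiE) (auto simp: finite_edges)
  have "\<bar>f \<omega>\<bar> \<le> Max ?S" if "edge_path \<omega>" for \<omega>
  proof -
    have "f \<omega> = f (restrict \<omega> {1..t})"
      by (rule determinedD[OF assms]) auto
    moreover have "restrict \<omega> {1..t} \<in> {1..t} \<rightarrow>\<^sub>E E"
      using that by (auto simp: edge_path_def)
    ultimately show ?thesis using fin by (intro Max_ge) auto
  qed
  then show ?thesis by (rule that[of "Max ?S"])
qed

lemma determined_integrable: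
  fixes f :: "(nat \<Rightarrow> nat \<times> nat) \<Rightarrow> real"
  assumes "determined t f"
  shows "integrable (edge_process n E) f"
proof -
  interpret prob_space "edge_process n E" by (rule prob_space_edge_process)
  obtain B where B: "\<And>\<omega>. edge_path \<omega> \<Longrightarrow> \<bar>f \<omega>\<bar> \<le> B"
    using determined_bounded[OF assms] by blast
  have "AE \<omega> in edge_process n E. norm (f \<omega>) \<le> B"
    using edge_path_AE by eventually_elim (simp add: B)
  then show ?thesis
    using determined_measurable[OF assms] by (rule integrable_const_bound)
qed

lemma expec_mono:
  assumes "determined t f" "determined t g" "\<And>\<omega>. edge_path \<omega> \<Longrightarrow> f \<omega> \<le> g \<omega>"
  shows "expec f \<le> expec g"
proof (rule integral_mono_AE)
  show "AE \<omega> in edge_process n E. f \<omega> \<le> g \<omega>"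
    using edge_path_AE by eventually_elim (rule assms(3))
qed (rule determined_integrable[OF assms(1)] determined_integrable[OF assms(2)])+

lemma expec_add: "determined t f \<Longrightarrow> determined t g \<Longrightarrow> expec (\<lambda>\<omega>. f \<omega> + g \<omega>) = expec f + expec g"
  by (rule Bochner_Integration.integral_add) (rule determined_integrable, assumption)+

lemma expec_sum: "(\<And>i. i \<in> I \<Longrightarrow> determined t (f i)) \<Longrightarrow> expec (\<lambda>\<omega>. \<Sum>i\<in>I. f i \<omega>) = (\<Sum>i\<in>I. expec (f i))"
  by (rule Bochner_Integration.integral_sum) (rule determined_integrable, blast)

lemma expec_const: "expec (\<lambda>_. c) = c"
proof -
  interpret prob_space "edge_process n E" by (rule prob_space_edge_process)
  show ?thesis by (simp add: prob_space)
qed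

section \<open>Conditioning on all edges but one\<close>

text \<open>Fubini with coordinate \<open>i\<close> split off from the product; the inner integral
  is over a single edge and so is a finite sum.\<close>

lemma expec_fiber:
  fixes f :: "(nat \<Rightarrow> nat \<times> nat) \<Rightarrow> real"
  assumes f: "determined t f" and i: "1 \<le> i"
  shows "expec f = (\<integral>\<omega>. (\<Sum>e\<in>E. prb e * f (\<omega> (i := e)))
    \<partial>(\<Pi>\<^sub>M s\<in>{1..} - {i}. measure_pmf (edge_pmf n E)))"
proof -
  let ?p = "measure_pmf (edge_pmf n E)"
  let ?M' = "\<Pi>\<^sub>M s\<in>{1..} - {i}. ?p"
  interpret M': prob_space ?M' by (intro prob_space_PiM prob_space_measure_pmf)
  interpret pair_sigma_finite ?p ?M' ..
  have M: "edge_process n E = distr (?p \<Otimes>\<^sub>M ?M') (edge_process n E) (\<lambda>(x, X). X(i := x))"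
    using distr_pair_PiM_eq_PiM[of "{1..} - {i}" "\<lambda>_. ?p" i] i
    by (simp add: edge_process_def prob_space_measure_pmf insert_absorb)
  have m: "(\<lambda>(x, X). X(i := x)) \<in> ?p \<Otimes>\<^sub>M ?M' \<rightarrow>\<^sub>M edge_process n E"
  proof -
    have "(\<lambda>y. (snd y)(i := fst y)) \<in> ?p \<Otimes>\<^sub>M ?M' \<rightarrow>\<^sub>M (\<Pi>\<^sub>M s\<in>{1..}. ?p)"
      by (rule measurable_fun_upd[of _ "{1..} - {i}"]) (use i in auto)
    then show ?thesis by (simp add: edge_process_def case_prod_unfold)
  qed
  have fm: "f \<in> borel_measurable (edge_process n E)" by (rule determined_measurable) fact
  have int: "integrable (?p \<Otimes>\<^sub>M ?M') (\<lambda>(x, X). f (X(i := x)))"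
    using determined_integrable[OF f] integrable_distr_eq[OF m fm] M
    by (simp add: case_prod_unfold)
  have "expec f = (\<integral>y. f (case y of (x, X) \<Rightarrow> X(i := x)) \<partial>(?p \<Otimes>\<^sub>M ?M'))"
    by (subst M, rule integral_distr[OF m fm])
  also have "\<dots> = (\<integral>(x, X). f (X(i := x)) \<partial>(?p \<Otimes>\<^sub>M ?M'))"
    by (simp add: case_prod_unfold)
  also have "\<dots> = (\<integral>X. (\<integral>x. f (X(i := x)) \<partial>?p) \<partial>?M')"
    by (rule integral_snd[symmetric]) (fact int)
  also have "(\<lambda>X. \<integral>x. f (X(i := x)) \<partial>?p) = (\<lambda>X. \<Sum>e\<in>E. prb e * f (X(i := e)))"
  proof
    fix X
    have "(\<integral>x. f (X(i := x)) \<partial>?p) = (\<Sum>e\<in>E. f (X(i := e)) * pmf (edge_pmf n E) e)"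
      by (rule integral_measure_pmf_real)
        (auto simp: finite_edges set_pmf_iff pmf_edge_pmf[OF graph connected n_ge_2] split: if_splits)
    then show "(\<integral>x. f (X(i := x)) \<partial>?p) = (\<Sum>e\<in>E. prb e * f (X(i := e)))"
      by (simp add: pmf_edge_pmf[OF graph connected n_ge_2] mult.commute)
  qed
  finally show ?thesis .
qed

text \<open>The averaged function \<open>g\<close> no longer reads coordinate \<open>i\<close>, so
  averaging it once more changes nothing: \<open>f\<close> and \<open>g\<close> have the same
  integral over the remaining coordinates.\<close>

lemma expec_resample:
  fixes f :: "(nat \<Rightarrow> nat \<times> nat) \<Rightarrow> real"
  assumes f: "determined t f" and i: "1 \<le> i"
  shows "expec f = expec (\<lambda>\<omega>. \<Sum>e\<in>E. prb e * f (\<omega> (i := e)))"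
proof -
  define g where "g = (\<lambda>\<omega>. \<Sum>e\<in>E. prb e * f (\<omega> (i := e)))"
  have "determined t g"
    unfolding g_def by (rule determined_sum, rule determined_compose, rule determined_upd, rule f)
  from expec_fiber[OF this i] have "expec g =
      (\<integral>\<omega>. (\<Sum>e\<in>E. prb e * g (\<omega> (i := e))) \<partial>(\<Pi>\<^sub>M s\<in>{1..} - {i}. measure_pmf (edge_pmf n E)))" .
  also have "(\<lambda>\<omega>. \<Sum>e\<in>E. prb e * g (\<omega> (i := e))) = g"
  proof
    fix \<omega>
    have "g (\<omega> (i := e)) = g \<omega>" for e by (simp add: g_def)
    then show "(\<Sum>e\<in>E. prb e * g (\<omega> (i := e))) = g \<omega>" by (simp add: sum_prb flip: sum_distrib_right)
  qed
  finally show ?thesis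
    using expec_fiber[OF assms] by (simp add: g_def)
qed

lemma expec_cong:
  assumes "determined t f" "determined t g" "\<And>\<omega>. edge_path \<omega> \<Longrightarrow> f \<omega> = g \<omega>"
  shows "expec f = expec g"
  by (rule antisym; rule expec_mono[OF assms(1,2)] expec_mono[OF assms(2,1)]; simp add: assms(3))

lemma edge_path_upd: "edge_path \<omega> \<Longrightarrow> e \<in> E \<Longrightarrow> edge_path (\<omega> (i := e))"
  by (simp add: edge_path_def)

text \<open>The tower property in the form used by both recursions: the new edge \<open>e\<close> is
  averaged out while \<open>g e\<close> is already known at time \<open>t\<close>.\<close>

lemma expec_step:
  fixes f :: "(nat \<Rightarrow> nat \<times> nat) \<Rightarrow> real" and g :: "nat \<times> nat \<Rightarrow> (nat \<Rightarrow> nat \<times> nat) \<Rightarrow> real"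
  assumes f: "determined (Suc t) f" and g: "\<And>e. e \<in> E \<Longrightarrow> determined t (g e)"
    and eq: "\<And>\<omega>. edge_path \<omega> \<Longrightarrow> f \<omega> = g (\<omega> (Suc t)) \<omega>"
  shows "expec f = expec (\<lambda>\<omega>. \<Sum>e\<in>E. prb e * g e \<omega>)"
proof -
  have "expec f = expec (\<lambda>\<omega>. \<Sum>e\<in>E. prb e * f (\<omega> (Suc t := e)))"
    by (rule expec_resample[OF f]) simp
  also have "\<dots> = expec (\<lambda>\<omega>. \<Sum>e\<in>E. prb e * g e \<omega>)"
  proof (rule expec_cong)
    show "determined (Suc t) (\<lambda>\<omega>. \<Sum>e\<in>E. prb e * f (\<omega> (Suc t := e)))"
      by (intro determined_sum determined_compose[OF determined_upd[OF f], where h = "(*) _"])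
    show "determined (Suc t) (\<lambda>\<omega>. \<Sum>e\<in>E. prb e * g e \<omega>)"
      by (intro determined_sum determined_compose[OF determined_mono[OF g], where h = "(*) _"]) simp_all
    fix \<omega> assume \<omega>: "edge_path \<omega>"
    show "(\<Sum>e\<in>E. prb e * f (\<omega> (Suc t := e))) = (\<Sum>e\<in>E. prb e * g e \<omega>)"
    proof (rule sum.cong)
      fix e assume e: "e \<in> E"
      moreover have "g e (\<omega> (Suc t := e)) = g e \<omega>" by (rule determinedD[OF g[OF e]]) simp
      ultimately show "prb e * f (\<omega> (Suc t := e)) = prb e * g e \<omega>"
        using eq[OF edge_path_upd[OF \<omega>, of e "Suc t"]] by simp
    qed simp
  qed
  finally show ?thesis .
qed

section \<open>Contraction by swapping and averaging\<close>

abbreviation nrm :: "(nat \<Rightarrow> real) \<Rightarrow> real" where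
  "nrm x \<equiv> L2_set x {..<n}"

definition swap_at :: "nat \<times> nat \<Rightarrow> (nat \<Rightarrow> real) \<Rightarrow> nat \<Rightarrow> real" where
  "swap_at e x k = x (Transposition.transpose (fst e) (snd e) k)"

definition average_at :: "nat \<times> nat \<Rightarrow> (nat \<Rightarrow> real) \<Rightarrow> nat \<Rightarrow> real" where
  "average_at e x k = (if k = fst e \<or> k = snd e then (x (fst e) + x (snd e)) / 2 else x k)"

definition mean_swap :: "(nat \<Rightarrow> real) \<Rightarrow> nat \<Rightarrow> real" where
  "mean_swap x k = (\<Sum>e\<in>E. prb e * swap_at e x k)"

lemma nrm_square: "(nrm x)\<^sup>2 = (\<Sum>k<n. (x k)\<^sup>2)"
  by (simp add: L2_set_def sum_nonneg)

lemma sum_swap_at: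
  assumes "e \<in> E"
  shows "(\<Sum>k<n. h (swap_at e x k)) = (\<Sum>k<n. h (x k))"
proof -
  have "Transposition.transpose (fst e) (snd e) permutes {..<n}"
    using edge_less[OF assms] by (intro permutes_swap_id) auto
  from sum.permute[OF this, of "\<lambda>k. h (x k)"] show ?thesis
    by (simp add: swap_at_def o_def)
qed

text \<open>With \<open>h\<close> the identity this gives conservation of the sum, with
  \<open>h\<close> the square the loss of energy along the edge.\<close>

lemma sum_average_at_diff:
  fixes h :: "real \<Rightarrow> real"
  assumes e: "e \<in> E"
  shows "(\<Sum>k<n. h (average_at e x k)) - (\<Sum>k<n. h (x k)) =
    2 * h ((x (fst e) + x (snd e)) / 2) - h (x (fst e)) - h (x (snd e))"
proof -
  have "(\<Sum>k<n. h (average_at e x k)) - (\<Sum>k<n. h (x k)) =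
      (\<Sum>k<n. h (average_at e x k) - h (x k))"
    by (simp add: sum_subtractf)
  also have "\<dots> = (\<Sum>k\<in>{fst e, snd e}. h (average_at e x k) - h (x k))"
    using edge_less[OF e] by (intro sum.mono_neutral_right) (auto simp: average_at_def)
  also have "\<dots> = 2 * h ((x (fst e) + x (snd e)) / 2) - h (x (fst e)) - h (x (snd e))"
    using edge_less[OF e] by (simp add: average_at_def)
  finally show ?thesis .
qed

lemma sum_average_at:
  assumes "e \<in> E"
  shows "(\<Sum>k<n. average_at e x k) = (\<Sum>k<n. x k)"
  using sum_average_at_diff[OF assms, of "\<lambda>y. y" x] by (simp add: field_simps)

lemma nrm_average_at:
  assumes "e \<in> E"
  shows "(nrm (average_at e x))\<^sup>2 = (nrm x)\<^sup>2 - (x (fst e) - x (snd e))\<^sup>2 / 2"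
  using sum_average_at_diff[OF assms, of "\<lambda>y. y\<^sup>2" x]
  unfolding nrm_square by (simp add: field_simps power2_eq_square)

lemma prb_variance:
  "(\<Sum>e\<in>E. prb e * (y e - (\<Sum>f\<in>E. prb f * y f))\<^sup>2) = (\<Sum>e\<in>E. prb e * (y e)\<^sup>2) - (\<Sum>e\<in>E. prb e * y e)\<^sup>2"
proof -
  define m where "m = (\<Sum>e\<in>E. prb e * y e)"
  have "(\<Sum>e\<in>E. prb e * (y e - m)\<^sup>2) =
      (\<Sum>e\<in>E. prb e * (y e)\<^sup>2 - 2 * m * (prb e * y e) + m\<^sup>2 * prb e)"
    by (rule sum.cong) (auto simp: power2_eq_square algebra_simps)
  also have "\<dots> = (\<Sum>e\<in>E. prb e * (y e)\<^sup>2) - 2 * m * m + m\<^sup>2 * 1"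
    unfolding sum.distrib sum_subtractf sum_distrib_left[symmetric] sum_prb m_def by simp
  finally show ?thesis by (simp add: m_def power2_eq_square)
qed

lemma prb_jensen: "(\<Sum>e\<in>E. prb e * y e)\<^sup>2 \<le> (\<Sum>e\<in>E. prb e * (y e)\<^sup>2)"
proof -
  have "0 \<le> (\<Sum>e\<in>E. prb e * (y e - (\<Sum>f\<in>E. prb f * y f))\<^sup>2)"
    by (intro sum_nonneg mult_nonneg_nonneg) (auto simp: edge_prob_nonneg)
  then show ?thesis unfolding prb_variance by simp
qed

lemma prb_lower_bound:
  obtains \<delta> where "0 < \<delta>" "\<And>e. e \<in> E \<Longrightarrow> \<delta> \<le> prb e"
proof
  show "0 < Min (prb ` E)" using prb_pos finite_edges edges_nonempty by simp
  show "Min (prb ` E) \<le> prb e" if "e \<in> E" for e using that finite_edges by simp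
qed

text \<open>
  Edge \<open>e\<close> moves the value of its second endpoint to its first one, \<open>i\<close>, whereas an edge avoiding \<open>i\<close>
  leaves it there. This spread makes the mean of the swaps contract strictly.
\<close>

lemma nrm_mean_swap:
  assumes \<delta>: "0 < \<delta>" "\<And>e. e \<in> E \<Longrightarrow> \<delta> \<le> prb e" and e: "e \<in> E"
  shows "(nrm (mean_swap x))\<^sup>2 \<le> (nrm x)\<^sup>2 - \<delta> / 2 * (x (fst e) - x (snd e))\<^sup>2"
proof -
  define i where "i = fst e"
  have i: "i < n" unfolding i_def using edge_less[OF e] by simp
  obtain f where f: "f \<in> E" "fst f \<noteq> i" "snd f \<noteq> i" using edge_avoiding[OF i] .
  \<comment> \<open>The variance, over the random edge, of the value arriving at node
    \<open>k\<close>. Each swap preserves the norm, so these variances add up to exactly the squared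
    norm lost by the mean swap.\<close>
  define v where "v k = (\<Sum>e\<in>E. prb e * (swap_at e x k - mean_swap x k)\<^sup>2)" for k
  have v0: "0 \<le> v k" for k
    unfolding v_def by (intro sum_nonneg mult_nonneg_nonneg) (auto simp: edge_prob_nonneg)
  have "e \<noteq> f" using f i_def by auto
  have "\<delta> / 2 * (x (fst e) - x (snd e))\<^sup>2 = \<delta> / 2 * (swap_at e x i - swap_at f x i)\<^sup>2"
    using f by (simp add: swap_at_def i_def Transposition.transpose_def power2_commute)
  also have "\<dots> \<le> \<delta> / 2 * (2 * ((swap_at e x i - mean_swap x i)\<^sup>2 + (swap_at f x i - mean_swap x i)\<^sup>2))"
  proof (rule mult_left_mono)
    define a b where "a = swap_at e x i - mean_swap x i" and "b = swap_at f x i - mean_swap x i"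
    have "(a - b)\<^sup>2 \<le> 2 * (a\<^sup>2 + b\<^sup>2)"
      using zero_le_power2[of "a + b"] by (simp add: power2_eq_square algebra_simps)
    then show "(swap_at e x i - swap_at f x i)\<^sup>2
        \<le> 2 * ((swap_at e x i - mean_swap x i)\<^sup>2 + (swap_at f x i - mean_swap x i)\<^sup>2)"
      by (simp add: a_def b_def)
  qed (use \<delta> in simp)
  also have "\<dots> \<le> prb e * (swap_at e x i - mean_swap x i)\<^sup>2 + prb f * (swap_at f x i - mean_swap x i)\<^sup>2"
    using \<delta>(2)[OF e] \<delta>(2)[OF f(1)] by (simp add: distrib_left add_mono mult_right_mono)
  also have "\<dots> = (\<Sum>e\<in>{e, f}. prb e * (swap_at e x i - mean_swap x i)\<^sup>2)"
    using \<open>e \<noteq> f\<close> by simp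
  also have "\<dots> \<le> v i"
    unfolding v_def using e f finite_edges
    by (intro sum_mono2) (auto simp: edge_prob_nonneg)
  also have "\<dots> \<le> (\<Sum>k<n. v k)"
    using i v0 by (intro member_le_sum) auto
  also have "\<dots> = (\<Sum>k<n. (\<Sum>e\<in>E. prb e * (swap_at e x k)\<^sup>2) - (mean_swap x k)\<^sup>2)"
    unfolding v_def mean_swap_def prb_variance ..
  also have "\<dots> = (\<Sum>e\<in>E. \<Sum>k<n. prb e * (swap_at e x k)\<^sup>2) - (nrm (mean_swap x))\<^sup>2"
    unfolding sum_subtractf nrm_square by (subst sum.swap) simp
  also have "(\<Sum>e\<in>E. \<Sum>k<n. prb e * (swap_at e x k)\<^sup>2) = (\<Sum>e\<in>E. prb e * (nrm x)\<^sup>2)"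
    unfolding nrm_square using sum_swap_at[where h = "\<lambda>y. y\<^sup>2"] by (simp flip: sum_distrib_left)
  also have "\<dots> = (nrm x)\<^sup>2" by (simp add: sum_prb flip: sum_distrib_right)
  finally show ?thesis by simp
qed

text \<open>A path from \<open>u\<close> to \<open>v\<close> accumulates at most its length times
  the largest jump across an edge. A single edge on the right is enough, because the losses of norm
  below are also estimated through one edge.\<close>

lemma poincare:
  obtains \<kappa> where "0 < \<kappa>"
    "\<And>x :: nat \<Rightarrow> real. (\<Sum>k<n. x k) = 0 \<Longrightarrow> \<exists>e\<in>E. (nrm x)\<^sup>2 \<le> \<kappa> * (x (fst e) - x (snd e))\<^sup>2"
proof
  define R where "R = E \<union> E\<inverse>"
  define N where "N = real (card R)"
  have finR: "finite R" unfolding R_def using finite_edges by simp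
  \<comment> \<open>Paths need at most \<open>N\<close> steps, so each of the \<open>n\<close>
    entries is at most \<open>N * D\<close> in absolute value; the added 1 secures strict
    positivity.\<close>
  show "0 < real n * N\<^sup>2 + 1" by (simp add: add_nonneg_pos)
  fix x :: "nat \<Rightarrow> real" assume x: "(\<Sum>k<n. x k) = 0"
  let ?g = "\<lambda>e. \<bar>x (fst e) - x (snd e)\<bar>"
  have "Max (?g ` E) \<in> ?g ` E" using finite_edges edges_nonempty by (intro Max_in) auto
  then obtain e where e: "e \<in> E" "Max (?g ` E) = ?g e" by blast
  define D where "D = ?g e"
  have D: "?g f \<le> D" if "f \<in> E" for f
    unfolding D_def e(2)[symmetric] using finite_edges that by simp
  have RD: "\<bar>x u - x v\<bar> \<le> D" if "(u, v) \<in> R" for u v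
    using that D[of "(u, v)"] D[of "(v, u)"] by (auto simp: R_def)
  have pow: "\<bar>x u - x v\<bar> \<le> real m * D" if "(u, v) \<in> R ^^ m" for m u v
    using that
  proof (induction m arbitrary: v)
    case (Suc m)
    then obtain w where "(u, w) \<in> R ^^ m" "(w, v) \<in> R" by auto
    with Suc.IH[of w] RD[of w v] show ?case by (simp add: algebra_simps)
  qed simp
  have all: "\<bar>x u - x v\<bar> \<le> N * D" if "u < n" "v < n" for u v
  proof -
    have "(u, v) \<in> R\<^sup>*" using connected that unfolding connected_graph_def R_def by blast
    then obtain m where m: "m \<le> card R" "(u, v) \<in> R ^^ m"
      unfolding rtrancl_finite_eq_relpow[OF finR] by auto
    have "real m * D \<le> N * D" unfolding N_def using m by (intro mult_right_mono) (auto simp: D_def)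
    then show ?thesis using pow[OF m(2)] by linarith
  qed
  have bnd: "\<bar>x u\<bar> \<le> N * D" if u: "u < n" for u
  proof -
    \<comment> \<open>As the entries sum to zero, \<open>n * x u\<close> is the sum of the
      differences \<open>x u - x v\<close>.\<close>
    have "real n * \<bar>x u\<bar> = \<bar>\<Sum>v<n. x u - x v\<bar>" using x by (simp add: sum_subtractf abs_mult)
    also have "\<dots> \<le> (\<Sum>v<n. \<bar>x u - x v\<bar>)" by (rule sum_abs)
    also have "\<dots> \<le> (\<Sum>v<n. N * D)" using all u by (intro sum_mono) auto
    finally show ?thesis using n_ge_2 by simp
  qed
  have "(nrm x)\<^sup>2 \<le> (\<Sum>k<n. (N * D)\<^sup>2)"
    unfolding nrm_square
  proof (intro sum_mono)
    fix k assume "k \<in> {..<n}"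
    then show "(x k)\<^sup>2 \<le> (N * D)\<^sup>2" using bnd[of k] by (intro abs_le_square_iff[THEN iffD1]) auto
  qed
  also have "\<dots> = real n * N\<^sup>2 * D\<^sup>2" by (simp add: power_mult_distrib)
  also have "\<dots> \<le> (real n * N\<^sup>2 + 1) * D\<^sup>2" by (intro mult_right_mono) auto
  finally show "\<exists>e\<in>E. (nrm x)\<^sup>2 \<le> (real n * N\<^sup>2 + 1) * (x (fst e) - x (snd e))\<^sup>2"
    using e(1) by (auto simp: D_def)
qed

text \<open>Mean swap and random average both lose at least \<open>\<delta> / 2\<close> times the
  squared jump across the edge of \<open>poincare\<close>, in squared norm. For the average, Jensen
  passes from the mean of squares to the mean norm.\<close>

lemma contraction:
  obtains q where "0 \<le> q" "q < 1"
    "\<And>x :: nat \<Rightarrow> real. (\<Sum>k<n. x k) = 0 \<Longrightarrow> nrm (mean_swap x) \<le> q * nrm x"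
    "\<And>x :: nat \<Rightarrow> real. (\<Sum>k<n. x k) = 0 \<Longrightarrow> (\<Sum>e\<in>E. prb e * nrm (average_at e x)) \<le> q * nrm x"
proof -
  obtain \<delta> where \<delta>: "0 < \<delta>" "\<And>e. e \<in> E \<Longrightarrow> \<delta> \<le> prb e" using prb_lower_bound by blast
  obtain \<kappa> where \<kappa>: "0 < \<kappa>"
    "\<And>x :: nat \<Rightarrow> real. (\<Sum>k<n. x k) = 0 \<Longrightarrow> \<exists>e\<in>E. (nrm x)\<^sup>2 \<le> \<kappa> * (x (fst e) - x (snd e))\<^sup>2"
    using poincare by blast
  \<comment> \<open>The cap \<open>1/2\<close> keeps \<open>1 - \<theta>\<close> positive, so that
    its root is a valid factor.\<close>
  define \<theta> where "\<theta> = min (1/2) (\<delta> / (2 * \<kappa>))"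
  have \<theta>: "0 < \<theta>" "\<theta> \<le> 1/2" using \<delta> \<kappa> by (auto simp: \<theta>_def)
  have gap: "\<exists>e\<in>E. (nrm x)\<^sup>2 - \<delta> / 2 * (x (fst e) - x (snd e))\<^sup>2 \<le> (1 - \<theta>) * (nrm x)\<^sup>2"
    if x: "(\<Sum>k<n. x k) = 0" for x
  proof -
    obtain e where e: "e \<in> E" "(nrm x)\<^sup>2 \<le> \<kappa> * (x (fst e) - x (snd e))\<^sup>2" using \<kappa>(2)[OF x] by blast
    have "\<theta> * (nrm x)\<^sup>2 \<le> \<delta> / (2 * \<kappa>) * (nrm x)\<^sup>2"
      by (intro mult_right_mono) (auto simp: \<theta>_def)
    also have "\<dots> \<le> \<delta> / (2 * \<kappa>) * (\<kappa> * (x (fst e) - x (snd e))\<^sup>2)"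
      using e(2) \<delta>(1) \<kappa>(1) by (intro mult_left_mono) auto
    also have "\<dots> = \<delta> / 2 * (x (fst e) - x (snd e))\<^sup>2" using \<kappa>(1) by simp
    finally show ?thesis using e(1) by (intro bexI[of _ e]) (auto simp: algebra_simps)
  qed
  have root: "a \<le> sqrt (1 - \<theta>) * b" if "a\<^sup>2 \<le> (1 - \<theta>) * b\<^sup>2" "0 \<le> b" for a b
  proof (rule power2_le_imp_le)
    show "a\<^sup>2 \<le> (sqrt (1 - \<theta>) * b)\<^sup>2" using that \<theta> by (simp add: power_mult_distrib)
  qed (use that \<theta> in simp)
  show ?thesis
  proof (rule that[of "sqrt (1 - \<theta>)"])
    show "0 \<le> sqrt (1 - \<theta>)" "sqrt (1 - \<theta>) < 1" using \<theta> by auto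
    fix x :: "nat \<Rightarrow> real" assume x: "(\<Sum>k<n. x k) = 0"
    obtain e where e: "e \<in> E" "(nrm x)\<^sup>2 - \<delta> / 2 * (x (fst e) - x (snd e))\<^sup>2 \<le> (1 - \<theta>) * (nrm x)\<^sup>2"
      using gap[OF x] by blast
    show "nrm (mean_swap x) \<le> sqrt (1 - \<theta>) * nrm x"
      using nrm_mean_swap[OF \<delta> e(1), of x] e(2) by (intro root) auto
    show "(\<Sum>e\<in>E. prb e * nrm (average_at e x)) \<le> sqrt (1 - \<theta>) * nrm x"
    proof (rule root)
      have "(\<Sum>e\<in>E. prb e * nrm (average_at e x))\<^sup>2 \<le> (\<Sum>f\<in>E. prb f * (nrm (average_at f x))\<^sup>2)"
        by (rule prb_jensen)
      also have "\<dots> = (\<Sum>f\<in>E. prb f * (nrm x)\<^sup>2 - prb f * ((x (fst f) - x (snd f))\<^sup>2 / 2))"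
        by (rule sum.cong) (auto simp: nrm_average_at right_diff_distrib)
      also have "\<dots> = (nrm x)\<^sup>2 - (\<Sum>f\<in>E. prb f * ((x (fst f) - x (snd f))\<^sup>2 / 2))"
        by (simp add: sum_subtractf sum_prb flip: sum_distrib_right)
      also have "\<dots> \<le> (nrm x)\<^sup>2 - prb e * ((x (fst e) - x (snd e))\<^sup>2 / 2)"
        using member_le_sum[OF e(1), of "\<lambda>f. prb f * ((x (fst f) - x (snd f))\<^sup>2 / 2)"] finite_edges
        by (simp add: edge_prob_nonneg)
      also have "\<dots> \<le> (nrm x)\<^sup>2 - \<delta> / 2 * (x (fst e) - x (snd e))\<^sup>2"
        using mult_right_mono[OF \<delta>(2)[OF e(1)], of "(x (fst e) - x (snd e))\<^sup>2"] by simp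
      finally show "(\<Sum>e\<in>E. prb e * nrm (average_at e x))\<^sup>2 \<le> (1 - \<theta>) * (nrm x)\<^sup>2"
        using e(2) by linarith
    qed simp
  qed
qed

section \<open>Swapping and averaging matrices as coordinate maps\<close>

lemma edge_laplacian_carrier [simp]: "edge_laplacian n e \<in> carrier_mat n n"
  by (simp add: edge_laplacian_def case_prod_unfold Let_def)

lemma swap_mat_carrier [simp]: "swap_mat n e \<in> carrier_mat n n"
  unfolding swap_mat_def by (rule minus_carrier_mat) simp

lemma avg_mat_carrier [simp]: "avg_mat n e \<in> carrier_mat n n"
  unfolding avg_mat_def by (intro minus_carrier_mat smult_carrier_mat) simp

text \<open>\<open>c = 1\<close> yields the swap and \<open>c = 1/2\<close> the average.\<close>

lemma identity_minus_laplacian_mult_vec: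
  assumes e: "e \<in> E" and v: "v \<in> carrier_vec n" and k: "k < n"
  shows "((1\<^sub>m n - c \<cdot>\<^sub>m edge_laplacian n e) *\<^sub>v v) $ k =
    v $ k - c * ((of_bool (k = fst e) - of_bool (k = snd e)) * (v $ fst e - v $ snd e))"
proof -
  have "((1\<^sub>m n - c \<cdot>\<^sub>m edge_laplacian n e) *\<^sub>v v) $ k =
      (\<Sum>l<n. (of_bool (k = l) - c * edge_laplacian n e $$ (k, l)) * v $ l)"
    using v k carrier_matD[OF edge_laplacian_carrier]
    by (auto simp: scalar_prod_def atLeast0LessThan intro!: sum.cong)
  also have "\<dots> = (\<Sum>l<n. (if l = k then v $ l else 0) -
      c * (of_bool (k = fst e) - of_bool (k = snd e)) *
           ((if l = fst e then v $ l else 0) - (if l = snd e then v $ l else 0)))"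
    by (rule sum.cong) (auto simp: edge_laplacian_index[OF e k] left_diff_distrib)
  also have "\<dots> = v $ k - c * (of_bool (k = fst e) - of_bool (k = snd e)) * (v $ fst e - v $ snd e)"
    using edge_less[OF e] k by (simp add: sum_subtractf flip: sum_distrib_left)
  finally show ?thesis by (simp add: mult.assoc)
qed

lemma swap_mat_mult_vec:
  assumes e: "e \<in> E" and v: "v \<in> carrier_vec n" and k: "k < n"
  shows "(swap_mat n e *\<^sub>v v) $ k = swap_at e (vec_index v) k"
proof -
  have "swap_mat n e = 1\<^sub>m n - 1 \<cdot>\<^sub>m edge_laplacian n e"
    unfolding swap_mat_def by (intro arg_cong2[of _ _ _ _ minus] eq_matI) auto
  then show ?thesis
    using identity_minus_laplacian_mult_vec[OF e v k, of 1] edge_less[OF e]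
    by (auto simp: swap_at_def Transposition.transpose_def)
qed

lemma avg_mat_mult_vec:
  assumes e: "e \<in> E" and v: "v \<in> carrier_vec n" and k: "k < n"
  shows "(avg_mat n e *\<^sub>v v) $ k = average_at e (vec_index v) k"
  using identity_minus_laplacian_mult_vec[OF e v k, of "1/2"] edge_less[OF e]
  by (auto simp: average_at_def avg_mat_def field_simps)

end

section \<open>Rank estimates\<close>

locale gotrim_data = sampled_graph +
  fixes X :: "real vec" and \<alpha> :: real
  assumes X: "X \<in> carrier_vec n" and inj_X: "inj_on (\<lambda>k. X $ k) {..<n}"
    and \<alpha>: "0 < \<alpha>" "\<alpha> < 1/2"
begin

lemma swapped_carrier [simp]: "swapped n X \<omega> s \<in> carrier_vec n"
proof (induction s)
  case (Suc s)
  then show ?case using mult_mat_vec_carrier[OF swap_mat_carrier] by simp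
qed (simp add: X)

lemma determined_swapped: "determined s (\<lambda>\<omega>. swapped n X \<omega> s)"
proof -
  have "swapped n X \<omega> s = swapped n X \<omega>' s" if "\<forall>i\<in>{1..s}. \<omega> i = \<omega>' i" for \<omega> \<omega>'
    using that by (induction s) auto
  then show ?thesis unfolding determined_def by blast
qed

lemma swapped_Suc:
  assumes "edge_path \<omega>" "k < n"
  shows "swapped n X \<omega> (Suc s) $ k = swap_at (\<omega> (Suc s)) (vec_index (swapped n X \<omega> s)) k"
  using swap_mat_mult_vec[OF _ swapped_carrier assms(2)] assms(1)
  by (simp add: edge_path_def)

text \<open>The mean over all nodes of the indicator that their value lies below that of
  \<open>k\<close>; this is the limit expected of the ergodic average at node
  \<open>k\<close>.\<close>

definition below_frac :: "nat \<Rightarrow> real" where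
  "below_frac k = (data_rank n X k - 1) / real n"

text \<open>The threshold node \<open>k\<close> and the location \<open>j\<close> are kept apart: as
  a function of \<open>j\<close> this is transported by the swaps, while the rank estimate reads it
  only at \<open>j = k\<close>.\<close>

definition below_dev :: "nat \<Rightarrow> (nat \<Rightarrow> nat \<times> nat) \<Rightarrow> nat \<Rightarrow> nat \<Rightarrow> real" where
  "below_dev k \<omega> s j = of_bool (X $ k > swapped n X \<omega> s $ j) - below_frac k"

lemma below_frac: "0 \<le> below_frac k" "below_frac k \<le> 1"
proof -
  have "(\<Sum>l<n. of_bool (X $ k > X $ l) :: real) \<le> (\<Sum>l<n. 1)" by (rule sum_mono) auto
  moreover have "0 \<le> (\<Sum>l<n. of_bool (X $ k > X $ l) :: real)" by (rule sum_nonneg) auto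
  ultimately show "0 \<le> below_frac k" "below_frac k \<le> 1"
    using n_ge_2 by (auto simp: below_frac_def data_rank_def field_simps)
qed

lemma below_dev_le: "\<bar>below_dev k \<omega> s j\<bar> \<le> 1"
  using below_frac[of k] by (auto simp: below_dev_def abs_le_iff)

lemma below_dev_Suc:
  assumes "edge_path \<omega>" "j < n"
  shows "below_dev k \<omega> (Suc s) j = swap_at (\<omega> (Suc s)) (below_dev k \<omega> s) j"
  using assms by (simp add: below_dev_def swapped_Suc swap_at_def del: swapped.simps)

lemma determined_below_dev: "determined s (\<lambda>\<omega>. below_dev k \<omega> s j)"
  unfolding below_dev_def
  by (rule determined_compose[OF determined_swapped, where h = "\<lambda>v. of_bool (X $ k > v $ j) - below_frac k"])

lemma sum_below_dev:
  assumes "edge_path \<omega>"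
  shows "(\<Sum>j<n. below_dev k \<omega> s j) = 0"
proof (induction s)
  case 0
  show ?case
    using n_ge_2 by (simp add: below_dev_def below_frac_def data_rank_def sum_subtractf)
next
  case (Suc s)
  have "(\<Sum>j<n. below_dev k \<omega> (Suc s) j) = (\<Sum>j<n. swap_at (\<omega> (Suc s)) (below_dev k \<omega> s) j)"
    using below_dev_Suc[OF assms] by (intro sum.cong) auto
  also have "\<dots> = 0"
    using sum_swap_at[of _ "\<lambda>y. y"] Suc assms by (simp add: edge_path_def)
  finally show ?case .
qed

definition below_sum :: "nat \<Rightarrow> (nat \<Rightarrow> nat \<times> nat) \<Rightarrow> nat \<Rightarrow> real" where
  "below_sum k \<omega> t = (\<Sum>s<t. below_dev k \<omega> s k)"

text \<open>The last summand sits at time \<open>t - 1\<close>, so the sum up to \<open>t\<close> is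
  known one edge earlier than its index suggests.\<close>

lemma determined_below_sum: "t \<le> Suc s \<Longrightarrow> determined s (\<lambda>\<omega>. below_sum k \<omega> t)"
  unfolding below_sum_def
  by (rule determined_sum, rule determined_mono, rule determined_below_dev) auto

lemma determined_swap_below_dev: "determined s (\<lambda>\<omega>. swap_at e (below_dev k \<omega> s) j)"
  unfolding swap_at_def by (rule determined_below_dev)

text \<open>Only \<open>j = k\<close> enters the variance, but the whole vector over
  \<open>j\<close> is needed, since swaps mix its entries and only the vector has a closed
  recursion.\<close>

definition covar :: "nat \<Rightarrow> nat \<Rightarrow> nat \<Rightarrow> real" where
  "covar k t j = expec (\<lambda>\<omega>. below_sum k \<omega> t * below_dev k \<omega> t j)"

lemma determined_covar: "determined t (\<lambda>\<omega>. below_sum k \<omega> t * below_dev k \<omega> t j)"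
  by (intro determined_mult determined_below_sum determined_below_dev) simp

text \<open>
  Conditioning on the first \<open>t\<close> edges turns the next swap into the mean swap, so the covariances
  satisfy a contracting affine recursion and stay bounded; no mixing time is needed.
\<close>

lemma covar_Suc:
  assumes "j < n"
  shows "covar k (Suc t) j =
    mean_swap (\<lambda>j. covar k t j + expec (\<lambda>\<omega>. below_dev k \<omega> t k * below_dev k \<omega> t j)) j"
proof -
  \<comment> \<open>\<open>below_sum\<close> at \<open>t + 1\<close> is fixed by the first
    \<open>t\<close> edges, so the new edge acts on the second factor alone.\<close>
  let ?g = "\<lambda>e \<omega>. below_sum k \<omega> (Suc t) * swap_at e (below_dev k \<omega> t) j"
  have d: "determined t (\<lambda>\<omega>. below_dev k \<omega> t k * below_dev k \<omega> t j)" for j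
    by (intro determined_mult determined_below_dev)
  have g: "determined t (?g e)" for e
    by (intro determined_mult determined_below_sum determined_swap_below_dev) simp
  have "covar k (Suc t) j = expec (\<lambda>\<omega>. \<Sum>e\<in>E. prb e * ?g e \<omega>)"
    unfolding covar_def
    by (rule expec_step[OF determined_covar g]) (simp add: below_dev_Suc assms)
  also have "\<dots> = (\<Sum>e\<in>E. expec (\<lambda>\<omega>. prb e * ?g e \<omega>))"
    by (intro expec_sum[of _ t] determined_compose[OF g, where h = "(*) _"])
  also have "\<dots> = (\<Sum>e\<in>E. prb e * expec (?g e))" by simp
  also have "\<dots> = (\<Sum>e\<in>E. prb e * swap_at e
      (\<lambda>j. covar k t j + expec (\<lambda>\<omega>. below_dev k \<omega> t k * below_dev k \<omega> t j)) j)"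
  proof (rule sum.cong)
    fix e
    have "expec (?g e) = expec (\<lambda>\<omega>.
       below_sum k \<omega> t * swap_at e (below_dev k \<omega> t) j + below_dev k \<omega> t k * swap_at e (below_dev k \<omega> t) j)"
      by (simp add: below_sum_def distrib_right)
    also have "\<dots> = swap_at e (\<lambda>j. covar k t j + expec (\<lambda>\<omega>. below_dev k \<omega> t k * below_dev k \<omega> t j)) j"
      unfolding swap_at_def covar_def by (rule expec_add[OF determined_covar d])
    finally show "prb e * expec (?g e) = prb e * swap_at e
      (\<lambda>j. covar k t j + expec (\<lambda>\<omega>. below_dev k \<omega> t k * below_dev k \<omega> t j)) j" by simp
  qed simp
  finally show ?thesis unfolding mean_swap_def .
qed

text \<open>Contraction holds only for vectors of sum zero; this provides that property for the
  moments, with \<open>f\<close> the accumulated sum or the current indicator at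
  \<open>k\<close>.\<close>

lemma sum_expec_mult_below_dev:
  assumes "determined t f"
  shows "(\<Sum>j<n. expec (\<lambda>\<omega>. f \<omega> * below_dev k \<omega> t j)) = 0"
proof -
  have d: "determined t (\<lambda>\<omega>. f \<omega> * below_dev k \<omega> t j)" for j
    by (intro determined_mult assms determined_below_dev)
  have "(\<Sum>j<n. expec (\<lambda>\<omega>. f \<omega> * below_dev k \<omega> t j)) = expec (\<lambda>\<omega>. \<Sum>j<n. f \<omega> * below_dev k \<omega> t j)"
    by (rule expec_sum[symmetric]) (rule d)
  also have "\<dots> = expec (\<lambda>_. 0)"
    by (rule expec_cong[OF determined_sum[OF d] determined_const])
      (simp add: sum_below_dev flip: sum_distrib_left)
  finally show ?thesis by simp
qed

lemma covar_bounded: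
  obtains B where "0 \<le> B" "\<And>k t. k < n \<Longrightarrow> covar k t k \<le> B"
proof -
  obtain q where q: "0 \<le> q" "q < 1"
    "\<And>x :: nat \<Rightarrow> real. (\<Sum>k<n. x k) = 0 \<Longrightarrow> nrm (mean_swap x) \<le> q * nrm x"
    by (rule contraction) (rule that; assumption)
  \<comment> \<open>The forcing term has norm at most \<open>n\<close>, and
    \<open>B * (1 - q) = n\<close> makes \<open>q * (B + n) \<le> B\<close>.\<close>
  define B where "B = real n / (1 - q)"
  have B: "0 \<le> B" using q by (simp add: B_def)
  have "nrm (covar k t) \<le> B" for k t
  proof (induction t)
    case 0
    have "covar k 0 j = 0" for j by (simp add: covar_def below_sum_def)
    then show ?case using B by (simp add: L2_set_def)
  next
    case (Suc t)
    define u where "u j = expec (\<lambda>\<omega>. below_dev k \<omega> t k * below_dev k \<omega> t j)" for j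
    have du: "determined t (\<lambda>\<omega>. below_dev k \<omega> t k * below_dev k \<omega> t j)" for j
      by (intro determined_mult determined_below_dev)
    have u: "\<bar>u j\<bar> \<le> 1" for j
    proof -
      have "\<bar>below_dev k \<omega> t k * below_dev k \<omega> t j\<bar> \<le> 1" for \<omega>
        using below_dev_le[of k \<omega> t k] below_dev_le[of k \<omega> t j] by (simp add: abs_mult mult_le_one)
      then have b: "below_dev k \<omega> t k * below_dev k \<omega> t j \<le> 1"
        "- 1 \<le> below_dev k \<omega> t k * below_dev k \<omega> t j" for \<omega>
        by (simp_all add: abs_le_iff minus_le_iff)
      have "u j \<le> expec (\<lambda>_. 1)"
        unfolding u_def by (rule expec_mono[OF du determined_const b(1)])
      moreover have "expec (\<lambda>_. - 1) \<le> u j"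
        unfolding u_def by (rule expec_mono[OF determined_const du b(2)])
      ultimately show ?thesis unfolding expec_const by simp
    qed
    have "nrm u \<le> (\<Sum>j<n. \<bar>u j\<bar>)" by (rule L2_set_le_sum_abs)
    also have "\<dots> \<le> real n" using sum_mono[of "{..<n}" "\<lambda>j. \<bar>u j\<bar>" "\<lambda>_. 1"] u by simp
    finally have nu: "nrm u \<le> real n" .
    have "nrm (covar k (Suc t)) = nrm (mean_swap (\<lambda>j. covar k t j + u j))"
      by (rule L2_set_cong) (simp_all add: covar_Suc u_def)
    also have "\<dots> \<le> q * nrm (\<lambda>j. covar k t j + u j)"
      using sum_expec_mult_below_dev[OF determined_below_sum[of t t], of k k]
        sum_expec_mult_below_dev[OF determined_below_dev[of t k k], of k]
      by (intro q(3)) (simp add: sum.distrib covar_def u_def)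
    also have "\<dots> \<le> q * (nrm (covar k t) + nrm u)"
      using q(1) by (intro mult_left_mono L2_set_triangle_ineq)
    also have "\<dots> \<le> q * (B + real n)"
      using q(1) Suc nu by (intro mult_left_mono) auto
    also have "\<dots> \<le> B"
    proof -
      have "B * (1 - q) = real n" using q by (simp add: B_def)
      moreover have "q * real n \<le> real n" using q by (simp add: mult_left_le_one_le)
      ultimately show ?thesis by (simp add: algebra_simps)
    qed
    finally show ?case .
  qed
  then have "covar k t k \<le> B" if "k < n" for k t
    using member_le_L2_set[of "{..<n}" k "covar k t"] that by (simp add: order_trans)
  then show ?thesis by (rule that[OF B])
qed

lemma rank_est_eq:
  assumes "1 \<le> t"
  shows "rank_est n X \<omega> t k - data_rank n X k = real n / real t * below_sum k \<omega> t"
proof -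
  have "(\<Sum>s=1..t. of_bool (X $ k > swapped n X \<omega> (s - 1) $ k)) =
      (\<Sum>s<t. of_bool (X $ k > swapped n X \<omega> s $ k) :: real)"
    by (rule sum.reindex_bij_witness[of _ Suc "\<lambda>s. s - 1"]) auto
  also have "\<dots> = below_sum k \<omega> t + real t * below_frac k"
    by (simp add: below_sum_def below_dev_def sum_subtractf)
  finally show ?thesis
    using assms n_ge_2 by (simp add: rank_est_def below_frac_def field_simps)
qed

text \<open>Each new term adds twice a bounded mixed moment and a square of at most 1, so the second
  moment of the sum grows at most linearly; dividing by the square of \<open>t\<close> leaves
  \<open>1/t\<close>.\<close>

lemma rank_est_variance:
  obtains C where "0 \<le> C"
    "\<And>k t. k < n \<Longrightarrow> 1 \<le> t \<Longrightarrow> expec (\<lambda>\<omega>. (rank_est n X \<omega> t k - data_rank n X k)\<^sup>2) \<le> C / real t"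
proof -
  obtain B where B: "0 \<le> B" "\<And>k t. k < n \<Longrightarrow> covar k t k \<le> B" by (rule covar_bounded) (rule that)
  have sq: "expec (\<lambda>\<omega>. (below_sum k \<omega> t)\<^sup>2) \<le> (2 * B + 1) * real t" if k: "k < n" for k t
  proof (induction t)
    case 0
    then show ?case by (simp add: below_sum_def)
  next
    case (Suc t)
    let ?a = "\<lambda>\<omega>. (below_sum k \<omega> t)\<^sup>2" let ?b = "\<lambda>\<omega>. 2 * (below_sum k \<omega> t * below_dev k \<omega> t k)"
    have da: "determined t ?a"
      by (rule determined_compose[where h = "\<lambda>y. y\<^sup>2"]) (simp add: determined_below_sum)
    have db: "determined t ?b" by (rule determined_compose[OF determined_covar, where h = "(*) 2"])
    have dab: "determined t (\<lambda>\<omega>. ?a \<omega> + ?b \<omega>)" by (rule determined_compose2[OF da db])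
    have dabc: "determined t (\<lambda>\<omega>. ?a \<omega> + ?b \<omega> + 1)" by (rule determined_compose[OF dab, where h = "\<lambda>y. y + 1"])
    have dS: "determined t (\<lambda>\<omega>. (below_sum k \<omega> (Suc t))\<^sup>2)"
      by (rule determined_compose[where h = "\<lambda>y. y\<^sup>2"]) (simp add: determined_below_sum)
    have "expec (\<lambda>\<omega>. (below_sum k \<omega> (Suc t))\<^sup>2) \<le> expec (\<lambda>\<omega>. ?a \<omega> + ?b \<omega> + 1)"
    proof (rule expec_mono[OF dS dabc])
      fix \<omega>
      have "(below_dev k \<omega> t k)\<^sup>2 \<le> 1" using below_dev_le[of k \<omega> t k] by (simp add: abs_square_le_1)
      then show "(below_sum k \<omega> (Suc t))\<^sup>2 \<le> ?a \<omega> + ?b \<omega> + 1"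
        by (simp add: below_sum_def power2_sum)
    qed
    also have "\<dots> = expec ?a + 2 * covar k t k + 1"
      unfolding expec_add[OF dab determined_const] expec_add[OF da db] expec_const
      by (simp add: covar_def)
    also have "\<dots> \<le> (2 * B + 1) * real (Suc t)"
      using Suc B(2)[OF k, of t] by (simp add: algebra_simps)
    finally show ?case .
  qed
  show ?thesis
  proof (rule that[of "(real n)\<^sup>2 * (2 * B + 1)"])
    fix k t :: nat assume k: "k < n" and t: "1 \<le> t"
    have "expec (\<lambda>\<omega>. (rank_est n X \<omega> t k - data_rank n X k)\<^sup>2) =
        (real n / real t)\<^sup>2 * expec (\<lambda>\<omega>. (below_sum k \<omega> t)\<^sup>2)"
      unfolding rank_est_eq[OF t] power_mult_distrib by simp
    also have "\<dots> \<le> (real n / real t)\<^sup>2 * ((2 * B + 1) * real t)"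
      using sq[OF k] by (intro mult_left_mono) auto
    also have "\<dots> = (real n)\<^sup>2 * (2 * B + 1) / real t"
      using t by (simp add: power2_eq_square field_simps)
    finally show "expec (\<lambda>\<omega>. (rank_est n X \<omega> t k - data_rank n X k)\<^sup>2) \<le> (real n)\<^sup>2 * (2 * B + 1) / real t" .
  qed (use B in simp)
qed

section \<open>The averaging recursion\<close>

lemma trim_count_less: "2 * trim_count n \<alpha> < n"
proof -
  have "real (trim_count n \<alpha>) \<le> \<alpha> * real n"
    using \<alpha> unfolding trim_count_def by (simp add: of_nat_nat)
  also have "\<dots> < 1 / 2 * real n" using \<alpha> n_ge_2 by (intro mult_strict_right_mono) auto
  finally show ?thesis by linarith
qed

lemma trim_const_pos: "0 < trim_const n \<alpha>"
  using trim_count_less n_ge_2 by (simp add: trim_const_def field_simps)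

lemma data_rank_card: "data_rank n X k = 1 + real (card {l. l < n \<and> X $ l < X $ k})"
proof -
  have "{..<n} \<inter> {l. X $ l < X $ k} = {l. l < n \<and> X $ l < X $ k}" by auto
  then show ?thesis by (simp add: data_rank_def)
qed

text \<open>An integer never equals a half-integer, so the denominators in \<open>K_vec\<close> are
  positive.\<close>

lemma rank_gap_pos: "0 < rank_gap n \<alpha> (data_rank n X k)"
proof -
  have "real i + 1/2 \<noteq> real j" for i j :: nat
  proof
    assume "real i + 1/2 = real j"
    then have "real (2 * i + 1) = real (2 * j)" by simp
    then have "2 * i + 1 = 2 * j" by (simp only: of_nat_eq_iff)
    then show False by presburger
  qed
  note half = this
  have "data_rank n X k \<noteq> trim_lo n \<alpha>"
    using half[of "trim_count n \<alpha>" "1 + card {l. l < n \<and> X $ l < X $ k}"]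
    by (simp add: data_rank_card trim_lo_def)
  moreover have "data_rank n X k \<noteq> trim_hi n \<alpha>"
    using half[of "n - trim_count n \<alpha>" "1 + card {l. l < n \<and> X $ l < X $ k}"] trim_count_less
    by (simp add: data_rank_card trim_hi_def of_nat_diff)
  ultimately show ?thesis by (simp add: rank_gap_def)
qed

text \<open>Ranks are integers and the trimming thresholds are half-integers, so an error below \<open>1/2\<close> is harmless.\<close>

lemma trim_weight_close:
  "\<bar>trim_weight n \<alpha> \<rho> - trim_weight n \<alpha> (data_rank n X k)\<bar> \<le> 4 / trim_const n \<alpha> * (\<rho> - data_rank n X k)\<^sup>2"
proof (cases "\<bar>\<rho> - data_rank n X k\<bar> < 1/2")
  case True
  define j where "j = 1 + card {l. l < n \<and> X $ l < X $ k}"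
  define m where "m = trim_count n \<alpha>"
  have r: "data_rank n X k = real j" by (simp add: data_rank_card j_def)
  have m: "m \<le> n" using trim_count_less by (simp add: m_def)
  have \<rho>: "real j - 1/2 < \<rho>" "\<rho> < real j + 1/2" using True unfolding r by linarith+
  have lo: "trim_lo n \<alpha> \<le> \<rho> \<longleftrightarrow> trim_lo n \<alpha> \<le> real j"
  proof (cases "m < j")
    case True
    then have "real m + 1 \<le> real j" by simp
    then show ?thesis using \<rho> by (simp add: trim_lo_def flip: m_def)
  next
    case False
    then have "real j \<le> real m" by simp
    then show ?thesis using \<rho> by (simp add: trim_lo_def flip: m_def)
  qed
  have hi: "\<rho> \<le> trim_hi n \<alpha> \<longleftrightarrow> real j \<le> trim_hi n \<alpha>"
  proof (cases "n - m < j")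
    case True
    then have "real n - real m + 1 \<le> real j" using m by linarith
    then show ?thesis using \<rho> by (simp add: trim_hi_def flip: m_def)
  next
    case False
    then have "real j \<le> real n - real m" using m by linarith
    then show ?thesis using \<rho> by (simp add: trim_hi_def flip: m_def)
  qed
  have "trim_weight n \<alpha> \<rho> = trim_weight n \<alpha> (data_rank n X k)"
    unfolding trim_weight_def r by (simp add: indicator_def lo hi)
  then show ?thesis using trim_const_pos by simp
next
  case False
  \<comment> \<open>Chebyshev in pathwise form: an error of at least \<open>1/2\<close> makes four
    times its square at least 1, while two weights differ by at most one jump.\<close>
  have "(1/2)\<^sup>2 \<le> \<bar>\<rho> - data_rank n X k\<bar>\<^sup>2" using False by (intro power_mono) auto
  then have sq: "1 \<le> 4 * (\<rho> - data_rank n X k)\<^sup>2" by (simp add: power2_eq_square)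
  have "\<bar>trim_weight n \<alpha> \<rho> - trim_weight n \<alpha> (data_rank n X k)\<bar> \<le> 1 / trim_const n \<alpha>"
    using trim_const_pos by (auto simp: trim_weight_def indicator_def)
  also have "\<dots> \<le> 4 * (\<rho> - data_rank n X k)\<^sup>2 / trim_const n \<alpha>"
    using trim_const_pos sq by (intro divide_right_mono) auto
  finally show ?thesis by simp
qed

section \<open>Recursion for the estimates and their mean\<close>

definition weight :: "(nat \<Rightarrow> nat \<times> nat) \<Rightarrow> nat \<Rightarrow> nat \<Rightarrow> real" where
  "weight \<omega> s k = gotrim_weights n \<alpha> X \<omega> s $ k"

definition limit_weight :: "nat \<Rightarrow> real" where
  "limit_weight k = trim_weight n \<alpha> (data_rank n X k)"

definition increment :: "(nat \<Rightarrow> nat \<times> nat) \<Rightarrow> nat \<Rightarrow> nat \<Rightarrow> real" where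
  "increment \<omega> s k = (weight \<omega> s k - weight \<omega> (s - 1) k) * X $ k"

definition estimate :: "(nat \<Rightarrow> nat \<times> nat) \<Rightarrow> nat \<Rightarrow> nat \<Rightarrow> real" where
  "estimate \<omega> t k = gotrim n \<alpha> X \<omega> t $ k"

text \<open>Written through the weights and not as an average of \<open>estimate\<close>: in this
  form it visibly depends on the first \<open>t - 1\<close> edges only. That it is the mean over
  nodes follows in \<open>sum_estimate\<close>.\<close>

definition estimate_mean :: "(nat \<Rightarrow> nat \<times> nat) \<Rightarrow> nat \<Rightarrow> real" where
  "estimate_mean \<omega> t = (\<Sum>k<n. weight \<omega> t k * X $ k) / real n"

lemma weight_0: "k < n \<Longrightarrow> weight \<omega> 0 k = 0"
  by (simp add: weight_def gotrim_weights_def)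

lemma weight_pos: "k < n \<Longrightarrow> 1 \<le> s \<Longrightarrow> weight \<omega> s k = trim_weight n \<alpha> (rank_est n X \<omega> s k)"
  by (simp add: weight_def gotrim_weights_def)

lemma determined_weight:
  assumes "t \<le> Suc s" "k < n"
  shows "determined s (\<lambda>\<omega>. weight \<omega> t k)"
proof (cases "t = 0")
  case True
  then show ?thesis using assms by (simp add: weight_0 determined_const)
next
  case False
  then have eq: "weight \<omega> t k = trim_weight n \<alpha> (data_rank n X k + real n / real t * below_sum k \<omega> t)" for \<omega>
    using weight_pos[OF assms(2), of t \<omega>] rank_est_eq[of t \<omega> k] by (simp add: algebra_simps)
  show ?thesis
    unfolding eq
    by (rule determined_compose[OF determined_below_sum[OF assms(1)],
          where h = "\<lambda>y. trim_weight n \<alpha> (data_rank n X k + real n / real t * y)"])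
qed

lemma determined_increment:
  assumes "t \<le> Suc s" "k < n"
  shows "determined s (\<lambda>\<omega>. increment \<omega> t k)"
  unfolding increment_def
  by (rule determined_compose2[OF determined_weight determined_weight, where h = "\<lambda>a b. (a - b) * X $ k"])
    (use assms in auto)

lemma determined_estimate_mean:
  assumes "t \<le> Suc s"
  shows "determined s (\<lambda>\<omega>. estimate_mean \<omega> t)"
proof -
  have "determined s (\<lambda>\<omega>. \<Sum>k<n. weight \<omega> t k * X $ k)"
    by (intro determined_sum determined_compose[OF determined_weight, where h = "\<lambda>a. a * _"])
      (use assms in auto)
  from determined_compose[OF this, where h = "\<lambda>a. a / real n"] show ?thesis
    by (simp add: estimate_mean_def)
qed

lemma gotrim_weights_carrier [simp]: "gotrim_weights n \<alpha> X \<omega> s \<in> carrier_vec n"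
  by (simp add: gotrim_weights_def)

lemma avg_prod_carrier [simp]: "avg_prod n \<omega> s t \<in> carrier_mat n n"
  by (induction t) (auto intro: mult_carrier_mat[OF avg_mat_carrier])

lemma avg_prod_empty: "t < s \<Longrightarrow> avg_prod n \<omega> s t = 1\<^sub>m n"
  by (cases t) auto

lemma estimate_0: "k < n \<Longrightarrow> estimate \<omega> 0 k = 0"
  by (simp add: estimate_def gotrim_def)

lemma average_at_sum: "average_at e (\<lambda>k. \<Sum>i\<in>I. x i k) k = (\<Sum>i\<in>I. average_at e (x i) k)"
  by (simp add: average_at_def sum.distrib flip: sum_divide_distrib)

lemma average_at_cong:
  assumes "\<And>k. k < n \<Longrightarrow> x k = y k" "e \<in> E" "k < n"
  shows "average_at e x k = average_at e y k"
  using assms edge_less[OF assms(2)] by (simp add: average_at_def)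

text \<open>Every product ending at \<open>t + 1\<close> has the newest averaging matrix as its left
  factor, also the one starting there; the new increment is thus added before averaging.\<close>

lemma estimate_Suc:
  assumes \<omega>: "edge_path \<omega>" and k: "k < n"
  shows "estimate \<omega> (Suc t) k =
    average_at (\<omega> (Suc t)) (\<lambda>k. estimate \<omega> t k + increment \<omega> (Suc t) k) k"
proof -
  let ?e = "\<omega> (Suc t)"
  define z where "z s = component_mult (gotrim_weights n \<alpha> X \<omega> s - gotrim_weights n \<alpha> X \<omega> (s - 1)) X" for s
  have dim: "dim_vec (gotrim_weights n \<alpha> X \<omega> s) = n" for s
    using carrier_vecD[OF gotrim_weights_carrier] .
  have z: "z s \<in> carrier_vec n" for s
    using X by (intro carrier_vecI) (simp add: z_def dim_component_mult dim)
  have zk: "z s $ k = increment \<omega> s k" if "k < n" for s k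
    using X that by (simp add: z_def component_mult_def increment_def weight_def dim)
  have e: "?e \<in> E" using \<omega> by (simp add: edge_path_def)
  have "estimate \<omega> (Suc t) k = (\<Sum>s=1..Suc t. (avg_prod n \<omega> s (Suc t) *\<^sub>v z s) $ k)"
    using k by (simp add: estimate_def gotrim_def z_def)
  also have "\<dots> = (\<Sum>s=1..Suc t. average_at ?e (vec_index (avg_prod n \<omega> s t *\<^sub>v z s)) k)"
  proof (rule sum.cong)
    fix s assume "s \<in> {1..Suc t}"
    then have "avg_prod n \<omega> s (Suc t) *\<^sub>v z s = avg_mat n ?e *\<^sub>v (avg_prod n \<omega> s t *\<^sub>v z s)"
      using assoc_mult_mat_vec[OF avg_mat_carrier avg_prod_carrier z] by simp
    then show "(avg_prod n \<omega> s (Suc t) *\<^sub>v z s) $ k = average_at ?e (vec_index (avg_prod n \<omega> s t *\<^sub>v z s)) k"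
      using avg_mat_mult_vec[OF e mult_mat_vec_carrier[OF avg_prod_carrier z] k] by simp
  qed simp
  also have "\<dots> = average_at ?e (\<lambda>k. \<Sum>s=1..Suc t. (avg_prod n \<omega> s t *\<^sub>v z s) $ k) k"
    by (rule average_at_sum[symmetric])
  also have "\<dots> = average_at ?e (\<lambda>k. estimate \<omega> t k + increment \<omega> (Suc t) k) k"
  proof (rule average_at_cong[OF _ e k])
    fix k assume k: "k < n"
    have "(\<Sum>s=1..t. (avg_prod n \<omega> s t *\<^sub>v z s) $ k) = estimate \<omega> t k"
      using k by (simp add: estimate_def gotrim_def z_def)
    \<comment> \<open>The product from \<open>t + 1\<close> to \<open>t\<close> is empty, hence the
      identity.\<close>
    moreover have "(avg_prod n \<omega> (Suc t) t *\<^sub>v z (Suc t)) $ k = increment \<omega> (Suc t) k"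
      using z zk[OF k] by (simp add: avg_prod_empty one_mult_mat_vec[OF z])
    ultimately show "(\<Sum>s=1..Suc t. (avg_prod n \<omega> s t *\<^sub>v z s) $ k) = estimate \<omega> t k + increment \<omega> (Suc t) k"
      by simp
  qed
  finally show ?thesis .
qed

lemma determined_estimate:
  assumes "k < n"
  shows "determined t (\<lambda>\<omega>. estimate \<omega> t k)"
proof -
  have "estimate \<omega> t k = estimate \<omega>' t k" if eq: "\<forall>s\<in>{1..t}. \<omega> s = \<omega>' s" for \<omega> \<omega>'
  proof -
    have A: "avg_prod n \<omega> s u = avg_prod n \<omega>' s u" if "u \<le> t" for s u
      using that eq by (induction u) auto
    have G: "gotrim_weights n \<alpha> X \<omega> s = gotrim_weights n \<alpha> X \<omega>' s" if "s \<le> t" for s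
    proof (rule eq_vecI)
      fix k assume "k < dim_vec (gotrim_weights n \<alpha> X \<omega>' s)"
      then have "k < n" using carrier_vecD[OF gotrim_weights_carrier] by simp
      then have "weight \<omega> s k = weight \<omega>' s k"
        using determinedD[OF determined_weight[of s t k], of \<omega> \<omega>'] that eq by auto
      then show "gotrim_weights n \<alpha> X \<omega> s $ k = gotrim_weights n \<alpha> X \<omega>' s $ k" by (simp add: weight_def)
    qed (simp add: carrier_vecD[OF gotrim_weights_carrier])
    show ?thesis
      using assms by (auto simp: estimate_def gotrim_def A G intro!: sum.cong)
  qed
  then show ?thesis unfolding determined_def by blast
qed

text \<open>Averaging keeps the sum, and the increments telescope because the weights start at
  0.\<close>

lemma sum_estimate:
  assumes \<omega>: "edge_path \<omega>"
  shows "(\<Sum>k<n. estimate \<omega> t k) = real n * estimate_mean \<omega> t"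
proof (induction t)
  case 0
  then show ?case using weight_0 by (simp add: estimate_0 estimate_mean_def)
next
  case (Suc t)
  have "(\<Sum>k<n. estimate \<omega> (Suc t) k) =
      (\<Sum>k<n. average_at (\<omega> (Suc t)) (\<lambda>k. estimate \<omega> t k + increment \<omega> (Suc t) k) k)"
    by (rule sum.cong) (simp_all add: estimate_Suc[OF \<omega>])
  also have "\<dots> = (\<Sum>k<n. estimate \<omega> t k + increment \<omega> (Suc t) k)"
    using \<omega> by (intro sum_average_at) (simp add: edge_path_def)
  also have "\<dots> = real n * estimate_mean \<omega> (Suc t)"
    using n_ge_2 unfolding sum.distrib Suc
    by (simp add: increment_def estimate_mean_def left_diff_distrib sum_subtractf)
  finally show ?case .
qed

lemma determined_nrm:
  assumes "\<And>k. k < n \<Longrightarrow> determined t (\<lambda>\<omega>. f \<omega> k)"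
  shows "determined t (\<lambda>\<omega>. nrm (f \<omega>))"
  using assms unfolding determined_def by (metis L2_set_cong lessThan_iff)

lemma expec_weight_dist:
  obtains C where "0 \<le> C"
    "\<And>k t. k < n \<Longrightarrow> 1 \<le> t \<Longrightarrow> expec (\<lambda>\<omega>. \<bar>weight \<omega> t k - limit_weight k\<bar>) \<le> C / real t"
proof -
  obtain C where C: "0 \<le> C"
    "\<And>k t. k < n \<Longrightarrow> 1 \<le> t \<Longrightarrow> expec (\<lambda>\<omega>. (rank_est n X \<omega> t k - data_rank n X k)\<^sup>2) \<le> C / real t"
    by (rule rank_est_variance) (rule that)
  let ?c = "4 / trim_const n \<alpha>"
  have c: "0 \<le> ?c" using trim_const_pos by simp
  show ?thesis
  proof (rule that[of "?c * C"])
    fix k t :: nat assume k: "k < n" and t: "1 \<le> t"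
    have eq: "rank_est n X \<omega> t k - data_rank n X k = real n / real t * below_sum k \<omega> t" for \<omega>
      by (rule rank_est_eq[OF t])
    have d2: "determined t (\<lambda>\<omega>. ?c * (rank_est n X \<omega> t k - data_rank n X k)\<^sup>2)"
      unfolding eq
      by (rule determined_compose[OF determined_below_sum[of t t], where h = "\<lambda>y. ?c * (real n / real t * y)\<^sup>2"]) simp
    have d1: "determined t (\<lambda>\<omega>. \<bar>weight \<omega> t k - limit_weight k\<bar>)"
      by (rule determined_compose[OF determined_weight[of t t k], where h = "\<lambda>y. \<bar>y - limit_weight k\<bar>"])
        (use k in auto)
    have "expec (\<lambda>\<omega>. \<bar>weight \<omega> t k - limit_weight k\<bar>) \<le>
        expec (\<lambda>\<omega>. ?c * (rank_est n X \<omega> t k - data_rank n X k)\<^sup>2)"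
      using trim_weight_close by (intro expec_mono[OF d1 d2]) (simp add: weight_pos[OF k t] limit_weight_def)
    also have "\<dots> = ?c * expec (\<lambda>\<omega>. (rank_est n X \<omega> t k - data_rank n X k)\<^sup>2)"
      by simp
    also have "\<dots> \<le> ?c * (C / real t)" using C(2)[OF k t] c by (rule mult_left_mono)
    finally show "expec (\<lambda>\<omega>. \<bar>weight \<omega> t k - limit_weight k\<bar>) \<le> ?c * C / real t" by simp
  qed (use c C in simp)
qed

text \<open>One quantity dominates two errors: the increments, through consecutive times, and the
  distance of \<open>estimate_mean\<close> from the trimmed mean.\<close>

definition weight_error :: "(nat \<Rightarrow> nat \<times> nat) \<Rightarrow> nat \<Rightarrow> real" where
  "weight_error \<omega> t = (\<Sum>k<n. \<bar>(weight \<omega> t k - limit_weight k) * X $ k\<bar>)"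

lemma expec_weight_error:
  obtains C where "0 \<le> C"
    "\<And>t. 1 \<le> t \<Longrightarrow> expec (\<lambda>\<omega>. weight_error \<omega> t) \<le> C / real t"
proof -
  obtain C where C: "0 \<le> C"
    "\<And>k t. k < n \<Longrightarrow> 1 \<le> t \<Longrightarrow> expec (\<lambda>\<omega>. \<bar>weight \<omega> t k - limit_weight k\<bar>) \<le> C / real t"
    by (rule expec_weight_dist) (rule that)
  show ?thesis
  proof (rule that[of "C * (\<Sum>k<n. \<bar>X $ k\<bar>)"])
    fix t :: nat assume t: "1 \<le> t"
    have "expec (\<lambda>\<omega>. weight_error \<omega> t) =
        (\<Sum>k<n. expec (\<lambda>\<omega>. \<bar>(weight \<omega> t k - limit_weight k) * X $ k\<bar>))"
      unfolding weight_error_def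
    proof (rule expec_sum[of _ t])
      fix k assume "k \<in> {..<n}"
      then show "determined t (\<lambda>\<omega>. \<bar>(weight \<omega> t k - limit_weight k) * X $ k\<bar>)"
        by (intro determined_compose[OF determined_weight[of t t k], where h = "\<lambda>y. \<bar>(y - limit_weight k) * X $ k\<bar>"]) auto
    qed
    also have "\<dots> = (\<Sum>k<n. expec (\<lambda>\<omega>. \<bar>weight \<omega> t k - limit_weight k\<bar>) * \<bar>X $ k\<bar>)"
      by (simp add: abs_mult)
    also have "\<dots> \<le> (\<Sum>k<n. C / real t * \<bar>X $ k\<bar>)"
      using C(2)[OF _ t] by (intro sum_mono mult_right_mono) auto
    also have "\<dots> = C * (\<Sum>k<n. \<bar>X $ k\<bar>) / real t"
      by (simp add: sum_distrib_left sum_divide_distrib)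
    finally show "expec (\<lambda>\<omega>. weight_error \<omega> t) \<le> C * (\<Sum>k<n. \<bar>X $ k\<bar>) / real t" .
  qed (use C in \<open>simp add: sum_nonneg\<close>)
qed


section \<open>Decay of the deviation from the mean\<close>

definition deviation :: "(nat \<Rightarrow> nat \<times> nat) \<Rightarrow> nat \<Rightarrow> nat \<Rightarrow> real" where
  "deviation \<omega> t k = estimate \<omega> t k - estimate_mean \<omega> t"

text \<open>Only the first \<open>t\<close> edges enter, because the rank estimate at time \<open>t + 1\<close> looks at the data before swap \<open>t + 1\<close>.\<close>

definition pre_average :: "(nat \<Rightarrow> nat \<times> nat) \<Rightarrow> nat \<Rightarrow> nat \<Rightarrow> real" where
  "pre_average \<omega> t k = estimate \<omega> t k + increment \<omega> (Suc t) k - estimate_mean \<omega> (Suc t)"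

lemma determined_deviation: "k < n \<Longrightarrow> determined t (\<lambda>\<omega>. deviation \<omega> t k)"
  unfolding deviation_def
  by (intro determined_diff determined_estimate determined_estimate_mean) auto

lemma determined_pre_average: "k < n \<Longrightarrow> determined t (\<lambda>\<omega>. pre_average \<omega> t k)"
  unfolding pre_average_def
  by (intro determined_diff determined_add determined_estimate determined_increment determined_estimate_mean) auto

lemma determined_weight_error:
  assumes "t \<le> Suc s"
  shows "determined s (\<lambda>\<omega>. weight_error \<omega> t)"
  unfolding weight_error_def
proof (rule determined_sum)
  fix k assume "k \<in> {..<n}"
  then show "determined s (\<lambda>\<omega>. \<bar>(weight \<omega> t k - limit_weight k) * X $ k\<bar>)"
    using assms
    by (intro determined_compose[OF determined_weight, where h = "\<lambda>y. \<bar>(y - limit_weight k) * X $ k\<bar>"]) auto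
qed

text \<open>Averaging fixes constants, so the new mean can be subtracted beforehand.\<close>

lemma deviation_Suc:
  assumes \<omega>: "edge_path \<omega>" and k: "k < n"
  shows "deviation \<omega> (Suc t) k = average_at (\<omega> (Suc t)) (pre_average \<omega> t) k"
  unfolding deviation_def estimate_Suc[OF assms]
  by (simp add: pre_average_def average_at_def field_simps)

lemma estimate_mean_diff:
  "real n * (estimate_mean \<omega> (Suc t) - estimate_mean \<omega> t) = (\<Sum>k<n. increment \<omega> (Suc t) k)"
  using n_ge_2 by (simp add: estimate_mean_def increment_def left_diff_distrib sum_subtractf flip: diff_divide_distrib)

lemma sum_pre_average:
  assumes "edge_path \<omega>"
  shows "(\<Sum>k<n. pre_average \<omega> t k) = 0"
  using estimate_mean_diff[of \<omega> t]
  by (simp add: pre_average_def sum_subtractf sum.distrib sum_estimate[OF assms] algebra_simps)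

text \<open>The factor 2 is the price of centring: subtracting the mean increment costs at most the
  total size \<open>S\<close> of the increments once more.\<close>

lemma nrm_pre_average:
  "nrm (pre_average \<omega> t) \<le> nrm (deviation \<omega> t) + 2 * (weight_error \<omega> t + weight_error \<omega> (Suc t))"
proof -
  define c where "c = estimate_mean \<omega> (Suc t) - estimate_mean \<omega> t"
  define S where "S = (\<Sum>k<n. \<bar>increment \<omega> (Suc t) k\<bar>)"
  have "real n * \<bar>c\<bar> = \<bar>\<Sum>k<n. increment \<omega> (Suc t) k\<bar>"
    unfolding c_def estimate_mean_diff[symmetric] by (simp add: abs_mult)
  then have c: "real n * \<bar>c\<bar> \<le> S" unfolding S_def by simp
  have "S \<le> (\<Sum>k<n. \<bar>(weight \<omega> (Suc t) k - limit_weight k) * X $ k\<bar> + \<bar>(weight \<omega> t k - limit_weight k) * X $ k\<bar>)"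
    unfolding S_def
  proof (rule sum_mono)
    fix k
    have "increment \<omega> (Suc t) k = (weight \<omega> (Suc t) k - limit_weight k) * X $ k - (weight \<omega> t k - limit_weight k) * X $ k"
      by (simp add: increment_def algebra_simps)
    then show "\<bar>increment \<omega> (Suc t) k\<bar> \<le>
      \<bar>(weight \<omega> (Suc t) k - limit_weight k) * X $ k\<bar> + \<bar>(weight \<omega> t k - limit_weight k) * X $ k\<bar>"
      by linarith
  qed
  then have S: "S \<le> weight_error \<omega> t + weight_error \<omega> (Suc t)"
    by (simp add: weight_error_def sum.distrib)
  have "nrm (\<lambda>k. increment \<omega> (Suc t) k - c) \<le> (\<Sum>k<n. \<bar>increment \<omega> (Suc t) k - c\<bar>)"
    by (rule L2_set_le_sum_abs)
  also have "\<dots> \<le> (\<Sum>k<n. \<bar>increment \<omega> (Suc t) k\<bar> + \<bar>c\<bar>)"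
    by (intro sum_mono abs_triangle_ineq4)
  also have "\<dots> = S + real n * \<bar>c\<bar>" by (simp add: S_def sum.distrib)
  also have "\<dots> \<le> S + S" using c by (rule add_left_mono)
  also have "\<dots> \<le> 2 * (weight_error \<omega> t + weight_error \<omega> (Suc t))" using S by simp
  finally have centred: "nrm (\<lambda>k. increment \<omega> (Suc t) k - c) \<le> 2 * (weight_error \<omega> t + weight_error \<omega> (Suc t))" .
  have "nrm (pre_average \<omega> t) = nrm (\<lambda>k. deviation \<omega> t k + (increment \<omega> (Suc t) k - c))"
    by (rule L2_set_cong) (auto simp: pre_average_def deviation_def c_def)
  also have "\<dots> \<le> nrm (deviation \<omega> t) + nrm (\<lambda>k. increment \<omega> (Suc t) k - c)"
    by (rule L2_set_triangle_ineq)
  also have "\<dots> \<le> nrm (deviation \<omega> t) + 2 * (weight_error \<omega> t + weight_error \<omega> (Suc t))"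
    using centred by (rule add_left_mono)
  finally show ?thesis .
qed

text \<open>Given the first \<open>t\<close> edges, the next average contracts
  \<open>pre_average\<close> in expected norm, which produces the recursion of
  \<open>geometric_reciprocal_bound\<close>.\<close>

lemma deviation_bound:
  obtains M where "\<And>t. 1 \<le> t \<Longrightarrow> expec (\<lambda>\<omega>. nrm (deviation \<omega> t)) \<le> M / real t"
proof -
  obtain q where q: "0 \<le> q" "q < 1"
    "\<And>x :: nat \<Rightarrow> real. (\<Sum>k<n. x k) = 0 \<Longrightarrow> (\<Sum>e\<in>E. prb e * nrm (average_at e x)) \<le> q * nrm x"
    by (rule contraction) (rule that; assumption)
  obtain C where C: "0 \<le> C"
    "\<And>t. 1 \<le> t \<Longrightarrow> expec (\<lambda>\<omega>. weight_error \<omega> t) \<le> C / real t"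
    by (rule expec_weight_error) (rule that)
  have dD: "determined t (\<lambda>\<omega>. nrm (deviation \<omega> t))" for t
    by (rule determined_nrm) (rule determined_deviation)
  have dM: "determined t (\<lambda>\<omega>. nrm (pre_average \<omega> t))" for t
    by (rule determined_nrm) (rule determined_pre_average)
  have step: "expec (\<lambda>\<omega>. nrm (deviation \<omega> (Suc t))) \<le>
      q * (expec (\<lambda>\<omega>. nrm (deviation \<omega> t)) + 6 * C / real (Suc t))" if t: "1 \<le> t" for t
  proof -
    let ?g = "\<lambda>e \<omega>. nrm (average_at e (pre_average \<omega> t))"
    have g: "determined t (?g e)" if "e \<in> E" for e
    proof (rule determined_nrm)
      fix k assume "k < n"
      have "determined t (\<lambda>\<omega>. (pre_average \<omega> t (fst e) + pre_average \<omega> t (snd e)) / 2)"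
        using determined_compose2[OF determined_pre_average[of "fst e"] determined_pre_average[of "snd e"],
            where h = "\<lambda>a b. (a + b) / 2"] edge_less[OF that] by simp
      then show "determined t (\<lambda>\<omega>. average_at e (pre_average \<omega> t) k)"
        unfolding average_at_def using determined_pre_average[OF \<open>k < n\<close>, of t] by (cases "k = fst e \<or> k = snd e") auto
    qed
    have dg: "determined t (\<lambda>\<omega>. \<Sum>e\<in>E. prb e * ?g e \<omega>)"
      by (intro determined_sum determined_compose[OF g, where h = "(*) _"])
    have dqM: "determined t (\<lambda>\<omega>. q * nrm (pre_average \<omega> t))"
      by (rule determined_compose[OF dM])
    have dW: "determined t (\<lambda>\<omega>. weight_error \<omega> t + weight_error \<omega> (Suc t))"
      by (intro determined_add determined_weight_error) auto
    have d2W: "determined t (\<lambda>\<omega>. 2 * (weight_error \<omega> t + weight_error \<omega> (Suc t)))"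
      by (rule determined_compose[OF dW])
    have "expec (\<lambda>\<omega>. nrm (deviation \<omega> (Suc t))) = expec (\<lambda>\<omega>. \<Sum>e\<in>E. prb e * ?g e \<omega>)"
    proof (rule expec_step[OF dD g])
      fix \<omega> assume "edge_path \<omega>"
      then show "nrm (deviation \<omega> (Suc t)) = nrm (average_at (\<omega> (Suc t)) (pre_average \<omega> t))"
        by (intro L2_set_cong) (auto simp: deviation_Suc)
    qed
    also have "\<dots> \<le> expec (\<lambda>\<omega>. q * nrm (pre_average \<omega> t))"
      by (rule expec_mono[OF dg dqM]) (intro q(3) sum_pre_average)
    also have "\<dots> = q * expec (\<lambda>\<omega>. nrm (pre_average \<omega> t))" by simp
    also have "\<dots> \<le> q * expec (\<lambda>\<omega>. nrm (deviation \<omega> t) + 2 * (weight_error \<omega> t + weight_error \<omega> (Suc t)))"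
      using q(1) by (intro mult_left_mono expec_mono[OF dM determined_add[OF dD d2W]] nrm_pre_average)
    also have "expec (\<lambda>\<omega>. nrm (deviation \<omega> t) + 2 * (weight_error \<omega> t + weight_error \<omega> (Suc t))) =
        expec (\<lambda>\<omega>. nrm (deviation \<omega> t)) + 2 * (expec (\<lambda>\<omega>. weight_error \<omega> t) + expec (\<lambda>\<omega>. weight_error \<omega> (Suc t)))"
    proof -
      have "expec (\<lambda>\<omega>. weight_error \<omega> t + weight_error \<omega> (Suc t)) =
          expec (\<lambda>\<omega>. weight_error \<omega> t) + expec (\<lambda>\<omega>. weight_error \<omega> (Suc t))"
        by (rule expec_add[of t]) (rule determined_weight_error, simp)+
      then show ?thesis unfolding expec_add[OF dD d2W] by (simp del: distrib_left_numeral)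
    qed
    also have "q * \<dots> \<le> q * (expec (\<lambda>\<omega>. nrm (deviation \<omega> t)) + 6 * C / real (Suc t))"
    proof (intro mult_left_mono add_left_mono)
      \<comment> \<open>For \<open>t \<ge> 1\<close> the bound at \<open>t\<close> is at most twice
        that at \<open>t + 1\<close>; twice the sum of \<open>2 * C\<close> and \<open>C\<close> is
        the constant \<open>6 * C\<close>.\<close>
      have "C / real t \<le> 2 * C / real (Suc t)"
        using t C(1) mult_left_mono[of 1 "real t" C] by (simp add: field_simps)
      then have "expec (\<lambda>\<omega>. weight_error \<omega> t) \<le> 2 * C / real (Suc t)" using C(2)[OF t] by linarith
      moreover have "expec (\<lambda>\<omega>. weight_error \<omega> (Suc t)) \<le> C / real (Suc t)" by (rule C(2)) simp
      ultimately show "2 * (expec (\<lambda>\<omega>. weight_error \<omega> t) + expec (\<lambda>\<omega>. weight_error \<omega> (Suc t))) \<le> 6 * C / real (Suc t)"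
        by (simp add: add_divide_distrib flip: distrib_right)
    qed (rule q(1))
    finally show ?thesis .
  qed
  have "0 \<le> 6 * C" using C(1) by simp
  then show ?thesis
    by (rule geometric_reciprocal_bound[where a = "\<lambda>t. expec (\<lambda>\<omega>. nrm (deviation \<omega> t))", OF q(1,2)])
      (erule step, rule that)
qed

text \<open>The error splits into the deviation from the mean and a constant vector
  \<open>c\<close>, whose norm is at most \<open>n * \<bar>c\<bar>\<close> and hence at most
  \<open>weight_error\<close>.\<close>

lemma gotrim_error_bound:
  obtains M where "0 \<le> M" "\<And>t. 1 \<le> t \<Longrightarrow> gotrim_error n E \<alpha> X t \<le> M / real t"
proof -
  obtain C where C: "0 \<le> C"
    "\<And>t. 1 \<le> t \<Longrightarrow> expec (\<lambda>\<omega>. weight_error \<omega> t) \<le> C / real t"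
    by (rule expec_weight_error) (rule that)
  obtain M where M: "\<And>t. 1 \<le> t \<Longrightarrow> expec (\<lambda>\<omega>. nrm (deviation \<omega> t)) \<le> M / real t"
    by (rule deviation_bound) (rule that)
  let ?m = "trimmed_mean n \<alpha> X"
  have dD: "determined t (\<lambda>\<omega>. nrm (deviation \<omega> t))" for t
    by (rule determined_nrm) (rule determined_deviation)
  have dW: "determined t (\<lambda>\<omega>. weight_error \<omega> t)" for t
    by (rule determined_weight_error) simp
  have dN: "determined t (\<lambda>\<omega>. nrm (\<lambda>k. estimate \<omega> t k - ?m))" for t
    by (rule determined_nrm) (rule determined_diff[OF determined_estimate determined_const])
  have norm: "vec_norm2 (gotrim n \<alpha> X \<omega> t - ?m \<cdot>\<^sub>v vec n (\<lambda>_. 1)) = nrm (\<lambda>k. estimate \<omega> t k - ?m)" for \<omega> t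
    unfolding vec_norm2_def by (rule L2_set_cong) (auto simp: estimate_def)
  have le: "nrm (\<lambda>k. estimate \<omega> t k - ?m) \<le> nrm (deviation \<omega> t) + weight_error \<omega> t" for \<omega> t
  proof -
    define c where "c = estimate_mean \<omega> t - ?m"
    have "real n * c = (\<Sum>k<n. (weight \<omega> t k - limit_weight k) * X $ k)"
      using n_ge_2
      by (simp add: c_def estimate_mean_def trimmed_mean_def limit_weight_def left_diff_distrib sum_subtractf right_diff_distrib)
    then have "real n * \<bar>c\<bar> = \<bar>\<Sum>k<n. (weight \<omega> t k - limit_weight k) * X $ k\<bar>"
      by (metis abs_mult abs_of_nat)
    then have c: "real n * \<bar>c\<bar> \<le> weight_error \<omega> t" unfolding weight_error_def by simp
    have "nrm (\<lambda>k. estimate \<omega> t k - ?m) = nrm (\<lambda>k. deviation \<omega> t k + c)"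
      by (simp add: deviation_def c_def)
    also have "\<dots> \<le> nrm (deviation \<omega> t) + nrm (\<lambda>_. c)" by (rule L2_set_triangle_ineq)
    finally show ?thesis using c L2_set_le_sum_abs[of "\<lambda>_. c" "{..<n}"] by simp
  qed
  show ?thesis
  proof (rule that[of "\<bar>M\<bar> + C"])
    fix t :: nat assume t: "1 \<le> t"
    have "gotrim_error n E \<alpha> X t = expec (\<lambda>\<omega>. nrm (\<lambda>k. estimate \<omega> t k - ?m))"
      unfolding gotrim_error_def norm ..
    also have "\<dots> \<le> expec (\<lambda>\<omega>. nrm (deviation \<omega> t) + weight_error \<omega> t)"
      by (rule expec_mono[OF dN determined_add[OF dD dW] le])
    also have "\<dots> = expec (\<lambda>\<omega>. nrm (deviation \<omega> t)) + expec (\<lambda>\<omega>. weight_error \<omega> t)"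
      by (rule expec_add[OF dD dW])
    also have "\<dots> \<le> M / real t + C / real t" using M[OF t] C(2)[OF t] by (rule add_mono)
    also have "\<dots> \<le> (\<bar>M\<bar> + C) / real t" by (simp add: add_divide_distrib divide_right_mono)
    finally show "gotrim_error n E \<alpha> X t \<le> (\<bar>M\<bar> + C) / real t" .
  qed (use C in simp)
qed

section \<open>Positivity of the right-hand side\<close>

text \<open>A smaller value elsewhere puts \<open>(r - 1) / n\<close> strictly between 0 and 1; at
  the minimal node \<open>rank_sigma\<close> vanishes.\<close>

lemma K_vec_pos:
  assumes k: "k < n" and l: "l < n" "X $ l < X $ k"
  shows "0 < K_vec n \<alpha> X $ k"
proof -
  let ?S = "{l. l < n \<and> X $ l < X $ k}"
  have fin: "finite ?S" by simp
  have "0 < card ?S" using l fin by (auto simp: card_gt_0_iff)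
  moreover have "card ?S < n"
  proof -
    have "card ?S < card {..<n}" by (rule psubset_card_mono) (use k in auto)
    then show ?thesis by simp
  qed
  ultimately have "0 < rank_sigma n (data_rank n X k)"
    by (simp add: rank_sigma_def data_rank_card Let_def)
  then show ?thesis
    using k rank_gap_pos \<alpha> by (simp add: K_vec_def Let_def)
qed

text \<open>Of three distinct values two are not the least, and at most one of these two is
  zero.\<close>

lemma weighted_norm_pos: "0 < vec_norm2 (component_mult (K_vec n \<alpha> X) X)"
proof -
  have lt: "0 < n" "1 < n" "2 < n" using n_ge_3 by auto
  have ne: "X $ 0 \<noteq> X $ 1" "X $ 1 \<noteq> X $ 2" "X $ 0 \<noteq> X $ 2"
    using inj_on_eq_iff[OF inj_X] lt by (metis lessThan_iff zero_neq_one zero_neq_numeral one_eq_numeral_iff semiring_norm(83))+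
  have "\<exists>k<n. X $ k \<noteq> 0 \<and> (\<exists>l<n. X $ l < X $ k)"
    using ne lt by (metis linorder_neq_iff)
  then obtain k l where kl: "k < n" "X $ k \<noteq> 0" "l < n" "X $ l < X $ k" by blast
  let ?v = "component_mult (K_vec n \<alpha> X) X"
  have dim: "dim_vec ?v = n" using X by (simp add: component_mult_def K_vec_def)
  have vk: "?v $ k = K_vec n \<alpha> X $ k * X $ k"
    using X kl by (simp add: component_mult_def K_vec_def)
  have "0 < (?v $ k)\<^sup>2"
    using K_vec_pos[OF kl(1,3,4)] kl(2) by (simp add: vk)
  also have "\<dots> \<le> (\<Sum>i<n. (?v $ i)\<^sup>2)"
    using kl(1) by (intro member_le_sum) auto
  finally show ?thesis by (simp add: vec_norm2_def dim L2_set_def)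
qed

end

theorem theorem3:
  fixes n :: nat and \<alpha> :: real
  assumes "2 \<le> n" "0 < \<alpha>" "\<alpha> < 1/2"
  shows "\<exists>C\<^sub>0>0. \<forall>(E :: (nat \<times> nat) set) (X :: real vec).
    graph_on n E \<longrightarrow> connected_graph n E \<longrightarrow> \<not> bipartite_graph n E \<longrightarrow>
    X \<in> carrier_vec n \<longrightarrow> inj_on (\<lambda>k. X $ k) {..<n} \<longrightarrow>
    (let c = second_smallest_eigenvalue (mean_laplacian n E);
         lam = second_largest_eigenvalue (mean_avg_mat n E);
         ct = 1 - sqrt lam
     in lam = 1 - c / 2 \<and>
        (\<exists>T>0::real. \<forall>t::nat. real t > T \<longrightarrow>
           gotrim_error n E \<alpha> X t
             \<le> C\<^sub>0 / (ct * sqrt (c * real t)) * vec_norm2 (component_mult (K_vec n \<alpha> X) X)))"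
proof (intro exI[of _ 1] conjI allI impI)
  fix E :: "(nat \<times> nat) set" and X :: "real vec"
  assume "graph_on n E" "connected_graph n E" "\<not> bipartite_graph n E"
    "X \<in> carrier_vec n" "inj_on (\<lambda>k. X $ k) {..<n}"
  then interpret gotrim_data n E X \<alpha>
    using assms by unfold_locales auto
  define c where "c = second_smallest_eigenvalue (mean_laplacian n E)"
  define lam where "lam = second_largest_eigenvalue (mean_avg_mat n E)"
  define ct where "ct = 1 - sqrt lam"
  define K where "K = vec_norm2 (component_mult (K_vec n \<alpha> X) X)"
  have c: "0 < c" unfolding c_def by (rule second_smallest_eigenvalue_pos)
  have lam: "lam = 1 - c / 2"
    unfolding lam_def c_def by (rule second_largest_eigenvalue_mean_avg_mat)
  \<comment> \<open>\<open>sqrt\<close> is increasing on all reals here, so \<open>lam < 1\<close>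
    is enough.\<close>
  have "sqrt lam < 1" using c by (simp add: lam)
  then have ct: "0 < ct" by (simp add: ct_def)
  have K: "0 < K" unfolding K_def by (rule weighted_norm_pos)
  obtain M where M: "0 \<le> M" "\<And>t. 1 \<le> t \<Longrightarrow> gotrim_error n E \<alpha> X t \<le> M / real t"
    by (rule gotrim_error_bound) (rule that)
  define \<kappa> where "\<kappa> = K / (ct * sqrt c)"
  have \<kappa>: "0 < \<kappa>" using c ct K by (simp add: \<kappa>_def)
  \<comment> \<open>The right side equals \<open>\<kappa> / sqrt t\<close>, which exceeds
    \<open>M / t\<close> once \<open>sqrt t\<close> reaches \<open>M / \<kappa>\<close>; the added 1
    in the threshold forces \<open>t \<ge> 1\<close>.\<close>
  have "gotrim_error n E \<alpha> X t \<le> 1 / (ct * sqrt (c * real t)) * K"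
    if t: "real t > (M / \<kappa>)\<^sup>2 + 1" for t
  proof -
    have "0 \<le> (M / \<kappa>)\<^sup>2" by simp
    with t have t1: "1 \<le> t" by linarith
    have "M / \<kappa> \<le> sqrt (real t)" using t by (intro real_le_rsqrt) linarith
    then have "M \<le> \<kappa> * sqrt (real t)" using \<kappa> by (simp add: field_simps)
    then have "M / real t \<le> \<kappa> * sqrt (real t) / real t" by (rule divide_right_mono) simp
    also have "\<dots> = \<kappa> / sqrt (real t)"
      using t1 by (simp add: field_simps)
    also have "\<dots> = 1 / (ct * sqrt (c * real t)) * K"
      by (simp add: \<kappa>_def real_sqrt_mult)
    finally show ?thesis using M(2)[OF t1] by linarith
  qed
  moreover have "0 < (M / \<kappa>)\<^sup>2 + 1" by (simp add: add_nonneg_pos)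
  ultimately show "let c = second_smallest_eigenvalue (mean_laplacian n E);
         lam = second_largest_eigenvalue (mean_avg_mat n E);
         ct = 1 - sqrt lam
     in lam = 1 - c / 2 \<and>
        (\<exists>T>0::real. \<forall>t::nat. real t > T \<longrightarrow>
           gotrim_error n E \<alpha> X t
             \<le> 1 / (ct * sqrt (c * real t)) * vec_norm2 (component_mult (K_vec n \<alpha> X) X))"
    using lam unfolding Let_def c_def lam_def ct_def K_def by blast
qed simp

end
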